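(* Let $U$ be a unitary operator on a Hilbert space $\mathcal{H}$, let $k\ge 1$, let $\{A_1,\dots,A_{2k-1}\}\subset\mathcal{K}(\mathcal{H})$ be compact operators on $\mathcal{H}$, and let $\alpha:\{1,\dots,2k\}\to\{1,\dots,k\}$ be a pair-partition of the set $\{1,\dots,2k\}$. Then the limit in the weak operator topology, as $N\to\infty$, of $$\frac{1}{N^{k}}\sum_{n_1,\dots,n_k=0}^{N-1}U^{n_{\alpha(1)}}A_1U^{n_{\alpha(2)}}\cdots U^{n_{\alpha(2k-1)}}A_{2k-1}U^{n_{\alpha(2k)}}$$ exists and is equal to $S_{\alpha;A_1,\dots,A_{2k-1}}$.
   Context: $\mathcal{B}(\mathcal{H})$ and $\mathcal{K}(\mathcal{H})$ denote the bounded and the compact operators on the (complex) Hilbert space $\mathcal{H}$. A pair-partition $\alpha:\{1,\dots,2k\}\to\{1,\dots,k\}$ is a surjective map each of whose preimages $\alpha^{-1}(\{j\})$, $j=1,\dots,k$, has exactly two elements. Let $\mathbb{T}$ be the unit circle, $\sigma_{\mathrm{pp}}(U)=\{z\in\mathbb{T} : z \text{ is an eigenvalue of } U\}$, and $\sigma_{\mathrm{pp}}^{\mathrm{a}}(U)=\{z\in\sigma_{\mathrm{pp}}(U) : zw=1\text{ for some }w\in\sigma_{\mathrm{pp}}(U)\}$. For $z\in\sigma_{\mathrm{pp}}(U)$, $E_z$ is the orthogonal projection onto the eigenspace of $U$ for the eigenvalue $z$. For a finite set $F\subset\sigma_{\mathrm{pp}}^{\mathrm{a}}(U)$ and $A_1,\dots,A_{2k-1}\in\mathcal{B}(\mathcal{H})$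 put $$S^{F}_{\alpha;A_1,\dots,A_{2k-1}}:=\sum_{z_1,\dots,z_k\in F}E_{z^{\#}_{\alpha(1)}}A_1E_{z^{\#}_{\alpha(2)}}\cdots E_{z^{\#}_{\alpha(2k-1)}}A_{2k-1}E_{z^{\#}_{\alpha(2k)}},$$ where, if $\alpha^{-1}(\{j\})=\{p<q\}$, then $z^{\#}_{\alpha(p)}=z_j$ and $z^{\#}_{\alpha(q)}=\bar z_j$. (For example, for $\alpha=\{1,2,1,2\}$ and operators $A,B,C$ this is $\sum_{z,w\in F}E_zAE_wBE_{\bar z}CE_{\bar w}$.) The operator $S_{\alpha;A_1,\dots,A_{2k-1}}$ is the limit in the weak operator topology (which exists) of the net $S^{F}_{\alpha;A_1,\dots,A_{2k-1}}$, indexed by the finite subsets $F$ of $\sigma_{\mathrm{pp}}^{\mathrm{a}}(U)$ directed by inclusion. *)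

theory Defs
  imports "HOL-Analysis.Analysis"
begin

text \<open>Complex Hilbert spaces; as usual for type classes, the space is the whole type.
  The inner product is conjugate-linear in its first argument.\<close>

class complex_inner = real_normed_vector +
  fixes scaleC :: "complex \<Rightarrow> 'a \<Rightarrow> 'a" (infixr \<open>*\<^sub>C\<close> 75)
    and cinner :: "'a \<Rightarrow> 'a \<Rightarrow> complex"
  assumes scaleC_add_right: "a *\<^sub>C (x + y) = a *\<^sub>C x + a *\<^sub>C y"
    and scaleC_add_left: "(a + b) *\<^sub>C x = a *\<^sub>C x + b *\<^sub>C x"
    and scaleC_scaleC: "a *\<^sub>C b *\<^sub>C x = (a * b) *\<^sub>C x"
    and scaleC_one: "1 *\<^sub>C x = x"
    and scaleR_scaleC: "r *\<^sub>R x = complex_of_real r *\<^sub>C x"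
    and cinner_commute: "cinner x y = cnj (cinner y x)"
    and cinner_add_left: "cinner (x + y) z = cinner x z + cinner y z"
    and cinner_scaleC_left: "cinner (a *\<^sub>C x) y = cnj a * cinner x y"
    and cinner_self_nonneg: "0 \<le> Re (cinner x x)"
    and cinner_eq_zero_iff: "cinner x x = 0 \<longleftrightarrow> x = 0"
    and norm_eq_sqrt_cinner: "norm x = sqrt (Re (cinner x x))"

class chilbert_space = complex_inner + complete_space

definition bounded_operator :: "('a::complex_inner \<Rightarrow> 'a) \<Rightarrow> bool" where
  "bounded_operator T \<longleftrightarrow> bounded_linear T \<and> (\<forall>c x. T (c *\<^sub>C x) = c *\<^sub>C T x)"

definition compact_operator :: "('a::complex_inner \<Rightarrow> 'a) \<Rightarrow> bool" where
  "compact_operator T \<longleftrightarrow> bounded_operator T \<and> compact (closure (T ` cball 0 1))"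

definition is_adjoint :: "('a::complex_inner \<Rightarrow> 'a) \<Rightarrow> ('a \<Rightarrow> 'a) \<Rightarrow> bool" where
  "is_adjoint T T' \<longleftrightarrow> bounded_operator T' \<and> (\<forall>x y. cinner (T x) y = cinner x (T' y))"

definition unitary_operator :: "('a::complex_inner \<Rightarrow> 'a) \<Rightarrow> bool" where
  "unitary_operator U \<longleftrightarrow> bounded_operator U \<and> (\<exists>U'. is_adjoint U U' \<and> U \<circ> U' = id \<and> U' \<circ> U = id)"

definition wot_tendsto :: "('i \<Rightarrow> 'a::complex_inner \<Rightarrow> 'a) \<Rightarrow> ('a \<Rightarrow> 'a) \<Rightarrow> 'i filter \<Rightarrow> bool" where
  "wot_tendsto T L F \<longleftrightarrow> bounded_operator L \<and>
     (\<forall>x y. ((\<lambda>i. cinner y (T i x)) \<longlongrightarrow> cinner y (L x)) F)"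

definition wot_Lim :: "'i filter \<Rightarrow> ('i \<Rightarrow> 'a::complex_inner \<Rightarrow> 'a) \<Rightarrow> 'a \<Rightarrow> 'a" where
  "wot_Lim F T = (THE L. wot_tendsto T L F)"

lemma wot_tendsto_unique:
  assumes "F \<noteq> bot" and L: "wot_tendsto T L F" and M: "wot_tendsto T M F"
  shows "L = M"
proof
  fix x
  have "cinner y (L x) = cinner y (M x)" for y
    using L M tendsto_unique[OF assms(1)] unfolding wot_tendsto_def by blast
  then have eq: "cinner (L x) y = cinner (M x) y" for y
    by (metis cinner_commute)
  have "cinner (L x - M x) y = 0" for y
    using cinner_add_left[of "L x - M x" "M x" y] eq by simp
  then show "L x = M x"
    using cinner_eq_zero_iff[of "L x - M x"] by simp
qed

lemma wot_Lim_eq: "F \<noteq> bot \<Longrightarrow> wot_tendsto T L F \<Longrightarrow> wot_Lim F T = L"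
  unfolding wot_Lim_def by (blast intro: wot_tendsto_unique)

definition sigma_pp :: "('a::complex_inner \<Rightarrow> 'a) \<Rightarrow> complex set" where
  "sigma_pp U = {z \<in> sphere 0 1. \<exists>x. x \<noteq> 0 \<and> U x = z *\<^sub>C x}"

definition sigma_pp_a :: "('a::complex_inner \<Rightarrow> 'a) \<Rightarrow> complex set" where
  "sigma_pp_a U = {z \<in> sigma_pp U. \<exists>w \<in> sigma_pp U. z * w = 1}"

definition eigenspace :: "('a::complex_inner \<Rightarrow> 'a) \<Rightarrow> complex \<Rightarrow> 'a set" where
  "eigenspace U z = {x. U x = z *\<^sub>C x}"

definition orth_proj :: "'a::complex_inner set \<Rightarrow> 'a \<Rightarrow> 'a" where
  "orth_proj M x = (THE y. y \<in> M \<and> (\<forall>m\<in>M. cinner m (x - y) = 0))"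

definition eigenproj :: "('a::complex_inner \<Rightarrow> 'a) \<Rightarrow> complex \<Rightarrow> 'a \<Rightarrow> 'a" where
  "eigenproj U z = orth_proj (eigenspace U z)"

definition pair_partition :: "nat \<Rightarrow> (nat \<Rightarrow> nat) \<Rightarrow> bool" where
  "pair_partition k \<alpha> \<longleftrightarrow> \<alpha> ` {1..2*k} = {1..k} \<and>
     (\<forall>j\<in>{1..k}. card {p \<in> {1..2*k}. \<alpha> p = j} = 2)"

text \<open>\<open>alt_prod X A m\<close> is the operator product
  \<open>X 1 \<circ> A 1 \<circ> X 2 \<circ> A 2 \<circ> \<dots> \<circ> X m \<circ> A m \<circ> X (m + 1)\<close>.\<close>

primrec alt_prod :: "(nat \<Rightarrow> 'a \<Rightarrow> 'a) \<Rightarrow> (nat \<Rightarrow> 'a \<Rightarrow> 'a) \<Rightarrow> nat \<Rightarrow> 'a \<Rightarrow> 'a" where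
  "alt_prod X A 0 = X 1"
| "alt_prod X A (Suc m) = alt_prod X A m \<circ> A (Suc m) \<circ> X (Suc (Suc m))"

text \<open>The spectral value at position \<open>p\<close> of the word: \<open>z j\<close> at the first of the two positions
  of the pair \<open>j\<close>, and its conjugate at the second one.\<close>

definition z_sharp :: "nat \<Rightarrow> (nat \<Rightarrow> nat) \<Rightarrow> (nat \<Rightarrow> complex) \<Rightarrow> nat \<Rightarrow> complex" where
  "z_sharp k \<alpha> z p =
     (if p = Min {q \<in> {1..2*k}. \<alpha> q = \<alpha> p} then z (\<alpha> p) else cnj (z (\<alpha> p)))"

definition S_partial ::
  "('a::complex_inner \<Rightarrow> 'a) \<Rightarrow> nat \<Rightarrow> (nat \<Rightarrow> nat) \<Rightarrow> (nat \<Rightarrow> 'a \<Rightarrow> 'a) \<Rightarrow> complex set \<Rightarrow> 'a \<Rightarrow> 'a" where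
  "S_partial U k \<alpha> A F x =
     (\<Sum>z \<in> {1..k} \<rightarrow>\<^sub>E F. alt_prod (\<lambda>p. eigenproj U (z_sharp k \<alpha> z p)) A (2*k - 1) x)"

definition S_op ::
  "('a::complex_inner \<Rightarrow> 'a) \<Rightarrow> nat \<Rightarrow> (nat \<Rightarrow> nat) \<Rightarrow> (nat \<Rightarrow> 'a \<Rightarrow> 'a) \<Rightarrow> 'a \<Rightarrow> 'a" where
  "S_op U k \<alpha> A = wot_Lim (finite_subsets_at_top (sigma_pp_a U)) (S_partial U k \<alpha> A)"

definition ergodic_average ::
  "('a::complex_inner \<Rightarrow> 'a) \<Rightarrow> nat \<Rightarrow> (nat \<Rightarrow> nat) \<Rightarrow> (nat \<Rightarrow> 'a \<Rightarrow> 'a) \<Rightarrow> nat \<Rightarrow> 'a \<Rightarrow> 'a" where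
  "ergodic_average U k \<alpha> A N x =
     (1 / real N ^ k) *\<^sub>R
       (\<Sum>n \<in> {1..k} \<rightarrow>\<^sub>E {0..<N}. alt_prod (\<lambda>p. U ^^ n (\<alpha> p)) A (2*k - 1) x)"

end

theory Submission imports Defs begin

text \<open>
  All limits are obtained in the strong topology. If every \<open>A j\<close> has rank one, the average factorizes over the
  pairs, and each factor is a correlation \<open>1/N \<Sum>n<N. g (U\<^sup>n b) U\<^sup>n a\<close>. Its limit is found by splitting off from
  \<open>a\<close> the finitely many components \<open>E\<^sub>z a\<close> of norm larger than \<open>\<epsilon>\<close>: on these the mean ergodic theorem applies,
  and the remainder \<open>r\<close> has all eigencomponents of norm at most \<open>\<epsilon>\<close>, so that by subadditivity and compactness of
  the circle its twisted averages \<open>1/N \<Sum>n<N. z\<^sup>-\<^sup>n U\<^sup>n r\<close> are eventually \<open>O(\<epsilon>)\<close> uniformly in \<open>z\<close>. A discrete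
  Fourier transform converts this into a bound for \<open>1/N \<Sum>n<N. c\<^sub>n U\<^sup>n r\<close> with arbitrary bounded coefficients.

  Compact operators are norm limits of finite rank operators, and both the averages and the spectral sums are
  multilinear in the \<open>A j\<close> and bounded by the product of their norms, uniformly in \<open>N\<close> and \<open>F\<close>. For the spectral
  sums this holds because they are averages, over phases, of products of contractions.
\<close>
section \<open>Complex inner product spaces\<close>

text \<open>The obstacle is that the two positions of a pair are separated by other operators, so
  the sum over one index cannot be carried out in isolation. Rank one operators remove it: each cuts
  the word, and a pair is left with a scalar \<open>g (Z t b)\<close> and a vector
  \<open>Y t a\<close>, coupled only through the common index \<open>t\<close>. When the large
  components of \<open>a\<close> are split off, \<open>b\<close> stays general. The coefficients
  \<open>g ((U ^^ n) b)\<close> then have no usable structure beyond boundedness, which is why the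
  estimate for the remainder has to admit arbitrary coefficients. A spectral sum has
  \<open>card F ^ k\<close> terms, so termwise estimates cannot carry the result from rank one to
  compact operators. A bound independent of \<open>F\<close> is essential because the difference of
  average and spectral sum is studied along both limits at once. Neither limit is assumed to exist:
  both are deduced from the vanishing of that difference.\<close>

lemma scaleC_zero_left [simp]: "0 *\<^sub>C (x::'a::complex_inner) = 0"
  by (metis add_cancel_right_left scaleC_add_left)

lemma scaleC_zero_right [simp]: "a *\<^sub>C (0::'a::complex_inner) = 0"
  by (metis add_cancel_right_left scaleC_add_right)

lemma scaleC_minus_right: "a *\<^sub>C (- x) = - (a *\<^sub>C (x::'a::complex_inner))"
  by (metis add.right_inverse neg_eq_iff_add_eq_0 scaleC_add_right scaleC_zero_right)

lemma scaleC_diff_right: "a *\<^sub>C (x - y) = a *\<^sub>C x - a *\<^sub>C (y::'a::complex_inner)"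
  using scaleC_add_right[of a x "- y"] by (simp add: scaleC_minus_right)

lemma cinner_add_right: "cinner x (y + z) = cinner x y + cinner (x::'a::complex_inner) z"
  by (metis cinner_add_left cinner_commute complex_cnj_add)

lemma cinner_scaleC_right: "cinner x (a *\<^sub>C y) = a * cinner (x::'a::complex_inner) y"
  by (metis cinner_commute cinner_scaleC_left complex_cnj_cnj complex_cnj_mult)

lemma cinner_zero_left [simp]: "cinner 0 (x::'a::complex_inner) = 0"
  by (metis add_cancel_right_left cinner_add_left)

lemma cinner_zero_right [simp]: "cinner (x::'a::complex_inner) 0 = 0"
  by (metis add_cancel_right_left cinner_add_right)

lemma cinner_minus_right: "cinner x (- y) = - cinner (x::'a::complex_inner) y"
  by (metis add.right_inverse cinner_add_right cinner_zero_right neg_eq_iff_add_eq_0)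

lemma cinner_diff_right: "cinner z (x - y) = cinner z x - cinner z (y::'a::complex_inner)"
  using cinner_add_right[of z x "- y"] by (simp add: cinner_minus_right)

lemma cinner_self: "cinner x x = complex_of_real ((norm (x::'a::complex_inner))\<^sup>2)"
proof -
  have "Im (cinner x x) = 0"
    by (metis cinner_commute cnj.simps(2) equal_neg_zero)
  moreover have "(norm x)\<^sup>2 = Re (cinner x x)"
    using norm_eq_sqrt_cinner[of x] cinner_self_nonneg[of x] by simp
  ultimately show ?thesis
    by (simp add: complex_eq_iff)
qed

lemma norm_sq_cinner: "(norm (x::'a::complex_inner))\<^sup>2 = Re (cinner x x)"
  by (simp add: cinner_self)

lemma cinner_ext:
  assumes "\<And>y. cinner y u = cinner y (v::'a::complex_inner)"
  shows "u = v"
  using assms[of "u - v"] cinner_eq_zero_iff[of "u - v"] by (simp add: cinner_diff_right)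

lemma norm_scaleC: "norm (a *\<^sub>C x) = cmod a * norm (x::'a::complex_inner)"
proof -
  have "complex_of_real ((norm (a *\<^sub>C x))\<^sup>2) = complex_of_real ((cmod a * norm x)\<^sup>2)"
    using complex_norm_square[of a]
    unfolding power_mult_distrib of_real_mult cinner_self[symmetric]
    by (simp add: cinner_scaleC_left cinner_scaleC_right mult_ac)
  then show ?thesis
    by (metis norm_ge_zero of_real_eq_iff power2_eq_iff_nonneg zero_le_mult_iff)
qed

lemma norm_add_sq:
  "(norm (x + y))\<^sup>2 = (norm x)\<^sup>2 + (norm y)\<^sup>2 + 2 * Re (cinner x (y::'a::complex_inner))"
proof -
  have "Re (cinner y x) = Re (cinner x y)"
    by (metis cinner_commute cnj.simps(1))
  then show ?thesis
    by (simp add: norm_sq_cinner cinner_add_left cinner_add_right)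
qed

lemma parallelogram_law:
  "(norm (x + y))\<^sup>2 + (norm (x - y))\<^sup>2 = 2 * (norm x)\<^sup>2 + 2 * (norm (y::'a::complex_inner))\<^sup>2"
  using norm_add_sq[of x y] norm_add_sq[of x "- y"] by (simp add: cinner_minus_right)

text \<open>Cauchy-Schwarz from Pythagoras: \<open>t *\<^sub>C x\<close> is the projection of
  \<open>y\<close> onto the line of \<open>x\<close>, so its norm is at most that of
  \<open>y\<close>.\<close>

lemma norm_cinner_le: "cmod (cinner x y) \<le> norm x * norm (y::'a::complex_inner)"
proof (cases "x = 0")
  case False
  define t where "t = cinner x y / cinner x x"
  define p where "p = y - t *\<^sub>C x"
  have nz: "cinner x x \<noteq> 0"
    using False cinner_eq_zero_iff by blast
  have "cinner x p = 0"
    using nz by (simp add: p_def t_def cinner_diff_right cinner_scaleC_right)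
  then have "cinner (t *\<^sub>C x) p = 0"
    by (simp add: cinner_scaleC_left)
  then have "(norm y)\<^sup>2 = (norm (t *\<^sub>C x))\<^sup>2 + (norm p)\<^sup>2"
    using norm_add_sq[of "t *\<^sub>C x" p] by (simp add: p_def)
  then have "(norm (t *\<^sub>C x))\<^sup>2 \<le> (norm y)\<^sup>2"
    by simp
  then have "cmod t * norm x \<le> norm y"
    using norm_ge_zero norm_scaleC power2_le_imp_le by metis
  moreover have "cmod t = cmod (cinner x y) / (norm x)\<^sup>2"
    by (simp add: t_def norm_divide cinner_self norm_power)
  ultimately show ?thesis
    using False by (simp add: field_simps power2_eq_square)
qed simp

lemma bounded_bilinear_scaleC:
  "bounded_bilinear (scaleC :: complex \<Rightarrow> 'a \<Rightarrow> 'a::complex_inner)"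
proof
  show "\<exists>K. \<forall>a b::'a. norm (a *\<^sub>C b) \<le> norm a * norm b * K"
    by (rule exI[of _ 1]) (simp add: norm_scaleC)
qed (simp_all add: scaleC_add_left scaleC_add_right scaleR_scaleC scaleC_scaleC scaleR_conv_of_real
    mult.commute)

lemma bounded_bilinear_cinner:
  "bounded_bilinear (cinner :: 'a::complex_inner \<Rightarrow> 'a \<Rightarrow> complex)"
proof
  show "\<exists>K. \<forall>a b::'a. norm (cinner a b) \<le> norm a * norm b * K"
    by (rule exI[of _ 1]) (simp add: norm_cinner_le)
qed (simp_all add: cinner_add_left cinner_add_right scaleR_scaleC cinner_scaleC_left
    cinner_scaleC_right scaleR_conv_of_real)

lemmas tendsto_scaleC = bounded_bilinear.tendsto[OF bounded_bilinear_scaleC]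
  and scaleC_sum_left = bounded_bilinear.sum_left[OF bounded_bilinear_scaleC]
  and scaleC_sum_right = bounded_bilinear.sum_right[OF bounded_bilinear_scaleC]
  and tendsto_cinner = bounded_bilinear.tendsto[OF bounded_bilinear_cinner]
  and cinner_sum_left = bounded_bilinear.sum_left[OF bounded_bilinear_cinner]
  and cinner_sum_right = bounded_bilinear.sum_right[OF bounded_bilinear_cinner]

lemma norm_sum_sq_orthogonal:
  fixes f :: "'i \<Rightarrow> 'a::complex_inner"
  assumes "finite S" "\<And>i j. i \<in> S \<Longrightarrow> j \<in> S \<Longrightarrow> i \<noteq> j \<Longrightarrow> cinner (f i) (f j) = 0"
  shows "(norm (\<Sum>i\<in>S. f i))\<^sup>2 = (\<Sum>i\<in>S. (norm (f i))\<^sup>2)"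
  using assms
proof (induction S rule: finite_induct)
  case (insert i S)
  have "cinner (f i) (\<Sum>j\<in>S. f j) = 0"
    unfolding cinner_sum_right using insert by (intro sum.neutral) auto
  then show ?case
    using insert by (simp add: norm_add_sq)
qed simp

section \<open>Bounded operators\<close>

lemma bounded_operator_linear: "bounded_operator T \<Longrightarrow> linear T"
  by (simp add: bounded_operator_def bounded_linear.linear)

lemma bounded_operator_scaleC: "bounded_operator T \<Longrightarrow> T (c *\<^sub>C x) = c *\<^sub>C T x"
  by (simp add: bounded_operator_def)

lemma bounded_operator_bound:
  assumes "bounded_operator T"
  obtains B where "B \<ge> 0" "\<And>x. norm (T x) \<le> B * norm x"
  using assms bounded_linear.nonneg_bounded unfolding bounded_operator_def
  by (metis mult.commute)

lemma bounded_operatorI: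
  assumes "\<And>x y. T (x + y) = T x + T y" "\<And>c x. T (c *\<^sub>C x) = c *\<^sub>C T x"
    "\<And>x. norm (T x) \<le> B * norm x"
  shows "bounded_operator T"
  unfolding bounded_operator_def
proof (intro conjI allI)
  show "bounded_linear T"
    using assms by (intro bounded_linear_intro[where K = B]) (auto simp: scaleR_scaleC mult.commute)
qed (use assms in auto)

lemma bounded_operator_id: "bounded_operator (\<lambda>x. x)"
  by (intro bounded_operatorI[where B = 1]) auto

lemma bounded_operator_compose:
  assumes "bounded_operator S" "bounded_operator T"
  shows "bounded_operator (S \<circ> T)"
  using assms by (auto simp: bounded_operator_def o_def intro: bounded_linear_compose)

lemma bounded_operator_scaled:
  assumes "bounded_operator T"
  shows "bounded_operator (\<lambda>x. c *\<^sub>C T x)"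
proof -
  obtain B where B: "B \<ge> 0" "\<And>x. norm (T x) \<le> B * norm x"
    using bounded_operator_bound[OF assms] by blast
  show ?thesis
    using assms B
    by (intro bounded_operatorI[where B = "cmod c * B"])
      (auto simp: linear_add bounded_operator_linear scaleC_add_right scaleC_scaleC norm_scaleC
        bounded_operator_scaleC mult.assoc mult.commute[of _ c] intro!: mult_left_mono)
qed

lemma bounded_operator_add:
  assumes "bounded_operator S" "bounded_operator T"
  shows "bounded_operator (\<lambda>x. S x + T x)"
  using assms by (auto simp: bounded_operator_def scaleC_add_right intro: bounded_linear_add)

lemma bounded_operator_diff:
  assumes "bounded_operator S" "bounded_operator T"
  shows "bounded_operator (\<lambda>x. S x - T x)"
  using assms by (auto simp: bounded_operator_def scaleC_diff_right intro: bounded_linear_sub)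

lemma bounded_operator_sum:
  assumes "\<And>i. i \<in> S \<Longrightarrow> bounded_operator (T i)"
  shows "bounded_operator (\<lambda>x. \<Sum>i\<in>S. T i x)"
  using assms by (auto simp: bounded_operator_def scaleC_sum_right intro: bounded_linear_sum)


section \<open>The mean ergodic theorem\<close>

text \<open>The class is stable under powers and unimodular multiples, so the ergodic theorem
  applies to every twist \<open>cnj z *\<^sub>C U x\<close>.\<close>

definition isometry_operator :: "('a::complex_inner \<Rightarrow> 'a) \<Rightarrow> bool" where
  "isometry_operator V \<longleftrightarrow> bounded_operator V \<and> (\<forall>x y. cinner (V x) (V y) = cinner x y)"

lemma unitary_isometry:
  assumes "unitary_operator U"
  shows "isometry_operator U"
proof -
  obtain U' where U': "bounded_operator U" "is_adjoint U U'" "U' \<circ> U = id"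
    using assms unfolding unitary_operator_def by blast
  have "cinner (U x) (U y) = cinner x y" for x y
    using U' by (metis comp_apply id_apply is_adjoint_def)
  with U' show ?thesis
    by (simp add: isometry_operator_def)
qed

context
  fixes V :: "'a::complex_inner \<Rightarrow> 'a"
  assumes V: "isometry_operator V"
begin

lemma isometry_bounded: "bounded_operator V"
  using V by (simp add: isometry_operator_def)

lemma isometry_funpow: "isometry_operator (V ^^ n)"
proof (induction n)
  case 0
  show ?case
    using bounded_operator_id by (simp add: isometry_operator_def id_def)
next
  case (Suc n)
  then show ?case
    using V bounded_operator_compose[of V "V ^^ n"] by (simp add: isometry_operator_def o_def)
qed

lemma isometry_cinner: "cinner (V x) (V y) = cinner x y"
  using V by (simp add: isometry_operator_def)

lemma isometry_norm: "norm (V x) = norm x"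
  by (simp add: norm_eq_sqrt_cinner isometry_cinner)

lemma isometry_scaled:
  assumes "cmod c = 1"
  shows "isometry_operator (\<lambda>x. c *\<^sub>C V x)"
proof -
  have "c * cnj c = 1"
    using complex_norm_square[of c] assms by simp
  then have "cinner (c *\<^sub>C V x) (c *\<^sub>C V y) = cinner x y" for x y
    by (simp add: cinner_scaleC_left cinner_scaleC_right isometry_cinner flip: mult.assoc)
  then show ?thesis
    by (simp add: isometry_operator_def bounded_operator_scaled isometry_bounded)
qed

lemma isometry_scaled_funpow: "((\<lambda>x. c *\<^sub>C V x) ^^ n) x = c ^ n *\<^sub>C (V ^^ n) x"
  by (induction n)
    (simp_all add: scaleC_one bounded_operator_scaleC isometry_bounded scaleC_scaleC)

end

section \<open>Averages along an orbit and the convex hull of the orbit\<close>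

definition cesaro :: "('a::complex_inner \<Rightarrow> 'a) \<Rightarrow> nat \<Rightarrow> 'a \<Rightarrow> 'a" where
  "cesaro V N x = (1 / real N) *\<^sub>R (\<Sum>n<N. (V ^^ n) x)"

context
  fixes V :: "'a::complex_inner \<Rightarrow> 'a"
  assumes V: "isometry_operator V"
begin

lemmas isometry_pow_linear = bounded_operator_linear[OF isometry_bounded[OF isometry_funpow[OF V]]]
lemmas isometry_pow_norm = isometry_norm[OF isometry_funpow[OF V]]

lemma cesaro_bounded_operator: "bounded_operator (cesaro V N)"
  unfolding cesaro_def scaleR_scaleC
  by (intro bounded_operator_scaled bounded_operator_sum isometry_bounded isometry_funpow V)

lemma norm_cesaro_le: "norm (cesaro V N x) \<le> norm x"
proof -
  have "norm (\<Sum>n<N. (V ^^ n) x) \<le> real N * norm x"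
    using sum_norm_bound[of "{..<N}" "\<lambda>n. (V ^^ n) x" "norm x"] by (simp add: isometry_pow_norm)
  then show ?thesis
    by (cases "N = 0") (simp_all add: cesaro_def field_simps)
qed

text \<open>A single shift telescopes: only the boundary terms \<open>(V ^^ N) u\<close> and
  \<open>u\<close> survive, each of norm \<open>norm u\<close>. The linear growth in
  \<open>j\<close> is harmless, since \<open>j\<close> stays fixed while \<open>N\<close>
  grows.\<close>

lemma norm_cesaro_shift: "norm (cesaro V N ((V ^^ j) x) - cesaro V N x) \<le> 2 * j * norm x / N"
proof (induction j)
  case (Suc j)
  have "(\<Sum>n<N. (V ^^ n) (V u)) - (\<Sum>n<N. (V ^^ n) u) = (V ^^ N) u - u" for u
    using sum_lessThan_telescope[of "\<lambda>n. (V ^^ n) u" N]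
    by (simp add: sum_subtractf funpow_swap1)
  then have "cesaro V N (V u) - cesaro V N u = (1 / real N) *\<^sub>R ((V ^^ N) u - u)" for u
    by (simp add: cesaro_def flip: scaleR_diff_right)
  then have "norm (cesaro V N (V u) - cesaro V N u) = (1 / real N) * norm ((V ^^ N) u - u)" for u
    by simp
  moreover have "norm ((V ^^ N) u - u) \<le> 2 * norm u" for u
    using norm_triangle_ineq4[of "(V ^^ N) u" u] by (simp add: isometry_pow_norm)
  ultimately have "norm (cesaro V N (V u) - cesaro V N u) \<le> 2 * norm u / N" for u
    by (simp add: divide_right_mono)
  from this[of "(V ^^ j) x"] Suc
  have "norm (cesaro V N ((V ^^ Suc j) x) - cesaro V N ((V ^^ j) x)) +
      norm (cesaro V N ((V ^^ j) x) - cesaro V N x) \<le> 2 * norm x / N + 2 * j * norm x / N"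
    by (intro add_mono) (auto simp: isometry_pow_norm)
  then show ?case
    using norm_triangle_ineq[of "cesaro V N ((V ^^ Suc j) x) - cesaro V N ((V ^^ j) x)"
        "cesaro V N ((V ^^ j) x) - cesaro V N x"]
    by (simp add: algebra_simps add_divide_distrib)
qed simp

lemma cesaro_in_hull:
  assumes "N > 0"
  shows "cesaro V N x \<in> convex hull (range (\<lambda>n. (V ^^ n) x))"
  unfolding cesaro_def scaleR_sum_right using assms
  by (intro convex_sum) (auto intro: hull_inc)

text \<open>Riesz' argument: averaging asymptotically identifies all points of the convex hull of an
  orbit, so the averages of \<open>x\<close> are a minimizing sequence for the norm on that hull.\<close>

lemma cesaro_hull_tendsto:
  assumes "c \<in> convex hull (range (\<lambda>n. (V ^^ n) x))"
  shows "(\<lambda>N. cesaro V N c - cesaro V N x) \<longlonglongrightarrow> 0"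
proof -
  let ?C = "{c. (\<lambda>N. cesaro V N c - cesaro V N x) \<longlonglongrightarrow> 0}"
  note lin = bounded_operator_linear[OF cesaro_bounded_operator]
  have "convex ?C"
  proof (rule convexI, clarsimp)
    fix c d and u v :: real
    assume c: "(\<lambda>N. cesaro V N c - cesaro V N x) \<longlonglongrightarrow> 0"
      and d: "(\<lambda>N. cesaro V N d - cesaro V N x) \<longlonglongrightarrow> 0" and uv: "u + v = 1"
    have "cesaro V N (u *\<^sub>R c + v *\<^sub>R d) - cesaro V N x =
        u *\<^sub>R (cesaro V N c - cesaro V N x) + v *\<^sub>R (cesaro V N d - cesaro V N x)" for N
      using uv by (simp add: linear_add[OF lin] linear_scale[OF lin] algebra_simps
          flip: scaleR_add_left)
    then show "(\<lambda>N. cesaro V N (u *\<^sub>R c + v *\<^sub>R d) - cesaro V N x) \<longlonglongrightarrow> 0"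
      using tendsto_add[OF tendsto_scaleR[OF tendsto_const c] tendsto_scaleR[OF tendsto_const d]]
      by simp
  qed
  moreover have "range (\<lambda>n. (V ^^ n) x) \<subseteq> ?C"
  proof clarsimp
    fix j :: nat
    have "(\<lambda>N. 2 * j * norm x / real N) \<longlonglongrightarrow> 0"
      by (rule lim_const_over_n)
    then show "(\<lambda>N. cesaro V N ((V ^^ j) x) - cesaro V N x) \<longlonglongrightarrow> 0"
      by (rule Lim_null_comparison[rotated]) (simp add: norm_cesaro_shift)
  qed
  ultimately show ?thesis
    using hull_minimal[of "range (\<lambda>n. (V ^^ n) x)" ?C convex] assms by auto
qed

end

text \<open>The averages lie in a convex set and their norms approach its infimum \<open>d\<close>.
  Midpoints stay in the set, hence have norm at least \<open>d\<close>, and the parallelogram law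
  turns this into smallness of the differences.\<close>

lemma cesaro_Cauchy:
  fixes V :: "'a::complex_inner \<Rightarrow> 'a"
  assumes V: "isometry_operator V"
  shows "Cauchy (\<lambda>N. cesaro V N x)"
proof (rule metric_CauchyI)
  fix e :: real assume e: "e > 0"
  let ?C = "convex hull (range (\<lambda>n. (V ^^ n) x))"
  define d where "d = Inf (norm ` ?C)"
  have bdd: "bdd_below (norm ` ?C)"
    by (rule bdd_belowI[of _ 0]) auto
  have ne: "norm ` ?C \<noteq> {}"
    by simp
  have d0: "d \<ge> 0"
    unfolding d_def using ne by (intro cInf_greatest) auto
  have dle: "d \<le> norm c" if "c \<in> ?C" for c
    unfolding d_def using bdd that by (intro cInf_lower) auto
  \<comment> \<open>Chosen backwards from the final estimate
    \<open>4 * ((2 * d + s) * s) < e\<^sup>2\<close>; the cap \<open>1\<close> allows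
    \<open>2 * d + s\<close> to be replaced by \<open>2 * d + 1\<close>.\<close>
  define s where "s = min 1 (e\<^sup>2 / (16 * (2 * d + 1)))"
  have s: "s > 0" "s \<le> 1" "16 * ((2 * d + 1) * s) \<le> e\<^sup>2"
  proof -
    have "s \<le> e\<^sup>2 / (16 * (2 * d + 1))"
      by (simp add: s_def)
    then show "16 * ((2 * d + 1) * s) \<le> e\<^sup>2"
      using d0 by (simp add: pos_le_divide_eq mult_ac)
  qed (use e d0 in \<open>auto simp: s_def\<close>)
  obtain c where c: "c \<in> ?C" "norm c < d + s / 2"
    using cInf_lessD[OF ne, of "d + s / 2"] s(1) unfolding d_def by auto
  obtain M where M: "\<And>N. N \<ge> M \<Longrightarrow> norm (cesaro V N c - cesaro V N x) < s / 2"
    using LIMSEQ_D[OF cesaro_hull_tendsto[OF V c(1)], of "s / 2"] s(1) by auto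
  have near: "norm (cesaro V N x) < d + s" if "N \<ge> M" for N
    using M[OF that] norm_cesaro_le[OF V, of N c] c(2)
      norm_triangle_ineq3[of "cesaro V N c" "cesaro V N x"] by linarith
  have "dist (cesaro V m x) (cesaro V n x) < e" if mn: "m \<ge> Suc M" "n \<ge> Suc M" for m n
  proof -
    let ?a = "cesaro V m x" and ?b = "cesaro V n x"
    have "(1/2) *\<^sub>R ?a + (1/2) *\<^sub>R ?b \<in> ?C"
      using mn by (intro convexD[OF convex_convex_hull] cesaro_in_hull V) auto
    from dle[OF this] have "d \<le> norm (?a + ?b) / 2"
      by (simp flip: scaleR_add_right)
    then have "(2 * d)\<^sup>2 \<le> (norm (?a + ?b))\<^sup>2"
      using d0 by (intro power_mono) auto
    moreover have "(norm ?a)\<^sup>2 \<le> (d + s)\<^sup>2" "(norm ?b)\<^sup>2 \<le> (d + s)\<^sup>2"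
      using near[of m] near[of n] mn by (auto intro!: power_mono)
    ultimately have "(norm (?a - ?b))\<^sup>2 \<le> 4 * (d + s)\<^sup>2 - 4 * d\<^sup>2"
      using parallelogram_law[of ?a ?b] by simp
    also have "\<dots> = 4 * ((2 * d + s) * s)"
      by (simp add: power2_eq_square algebra_simps)
    also have "\<dots> \<le> 4 * ((2 * d + 1) * s)"
      using s d0 by (intro mult_left_mono mult_right_mono) auto
    also have "\<dots> < e\<^sup>2"
      using s d0 by (smt (verit) mult_pos_pos)
    finally show ?thesis
      unfolding dist_norm using e by (intro power2_less_imp_less[of _ e]) auto
  qed
  then show "\<exists>M. \<forall>m\<ge>M. \<forall>n\<ge>M. dist (cesaro V m x) (cesaro V n x) < e"
    by blast
qed

text \<open>Since \<open>x\<close> and \<open>V x\<close> have asymptotically equal averages, the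
  limit is fixed by \<open>V\<close>. For a fixed vector \<open>m\<close>, writing \<open>m\<close>
  as \<open>(V ^^ n) m\<close> gives \<open>cinner m ((V ^^ n) x) = cinner m x\<close>, so all
  averages with \<open>N > 0\<close> have the same inner product with \<open>m\<close>. Together
  this characterizes \<open>y\<close> as the orthogonal projection of \<open>x\<close> onto the
  fixed space.\<close>

theorem mean_ergodic:
  fixes V :: "'a::chilbert_space \<Rightarrow> 'a"
  assumes V: "isometry_operator V"
  obtains y where "(\<lambda>N. cesaro V N x) \<longlonglongrightarrow> y" "V y = y"
    "\<And>m. V m = m \<Longrightarrow> cinner m (x - y) = 0"
proof -
  obtain y where y: "(\<lambda>N. cesaro V N x) \<longlonglongrightarrow> y"
    using cesaro_Cauchy[OF V] Cauchy_convergent convergent_def by blast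
  have comm: "V (cesaro V N x) = cesaro V N (V x)" for N
  proof -
    note lin = bounded_operator_linear[OF isometry_bounded[OF V]]
    show ?thesis
      by (simp add: cesaro_def linear_scale[OF lin] linear_sum[OF lin] funpow_swap1)
  qed
  have "bounded_linear V"
    using isometry_bounded[OF V] by (simp add: bounded_operator_def)
  then have "(\<lambda>N. V (cesaro V N x)) \<longlonglongrightarrow> V y"
    using y by (rule bounded_linear.tendsto)
  moreover have "V x \<in> range (\<lambda>n. (V ^^ n) x)"
    by (rule range_eqI[of _ _ 1]) simp
  then have "(\<lambda>N. cesaro V N (V x) - cesaro V N x) \<longlonglongrightarrow> 0"
    by (intro cesaro_hull_tendsto[OF V] hull_inc)
  ultimately have "(\<lambda>N. cesaro V N x) \<longlonglongrightarrow> V y - 0"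
    unfolding comm by (drule_tac tendsto_diff) auto
  then have "V y = y"
    using y LIMSEQ_unique by fastforce
  moreover have "cinner m (x - y) = 0" if m: "V m = m" for m
  proof -
    have "(V ^^ n) m = m" for n
      by (induction n) (simp_all add: m)
    then have inv: "cinner m ((V ^^ n) x) = cinner m x" for n
      using isometry_cinner[OF isometry_funpow[OF V, of n], of m x] by simp
    have "cinner m (cesaro V N x) = cinner m x" if "N > 0" for N
      using that by (simp add: cesaro_def scaleR_scaleC cinner_scaleC_right cinner_sum_right inv)
    then have "(\<lambda>N. cinner m (cesaro V N x)) \<longlonglongrightarrow> cinner m x"
      by (intro tendsto_eventually eventually_sequentiallyI[of 1]) auto
    moreover have "(\<lambda>N. cinner m (cesaro V N x)) \<longlonglongrightarrow> cinner m y"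
      by (intro tendsto_cinner tendsto_const y)
    ultimately show ?thesis
      using LIMSEQ_unique by (fastforce simp: cinner_diff_right)
  qed
  ultimately show thesis
    using that y by blast
qed

section \<open>Eigenprojections of an isometry\<close>

text \<open>On the circle \<open>cnj z\<close> is the inverse of \<open>z\<close>, so the fixed
  vectors of the twisted operator are the eigenvectors of \<open>U\<close> for
  \<open>z\<close>.\<close>

definition twisted_cesaro :: "('a::complex_inner \<Rightarrow> 'a) \<Rightarrow> complex \<Rightarrow> nat \<Rightarrow> 'a \<Rightarrow> 'a" where
  "twisted_cesaro U z = cesaro (\<lambda>x. cnj z *\<^sub>C U x)"

context
  fixes U :: "'a::chilbert_space \<Rightarrow> 'a"
  assumes U: "isometry_operator U"
begin

lemma isometry_twisted: "cmod z = 1 \<Longrightarrow> isometry_operator (\<lambda>x. cnj z *\<^sub>C U x)"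
  by (intro isometry_scaled U) simp

lemma eigenspace_iff_fixed:
  assumes "cmod z = 1"
  shows "x \<in> eigenspace U z \<longleftrightarrow> cnj z *\<^sub>C U x = x"
proof -
  have "z * cnj z = 1" "cnj z * z = 1"
    using complex_norm_square[of z] assms by (simp_all add: mult.commute)
  then have "z *\<^sub>C (cnj z *\<^sub>C U x) = U x" "cnj z *\<^sub>C (z *\<^sub>C x) = x"
    by (simp_all add: scaleC_scaleC scaleC_one)
  then show ?thesis
    unfolding eigenspace_def by auto
qed

text \<open>The definite description in \<open>orth_proj\<close> is resolved by uniqueness: two
  candidates differ by a vector of the eigenspace that is orthogonal to itself. Existence comes from
  the mean ergodic theorem.\<close>

lemma orth_proj_eqI:
  assumes "M = eigenspace U z" "y \<in> M" "\<And>m. m \<in> M \<Longrightarrow> cinner m (x - y) = 0"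
  shows "orth_proj M x = y"
  unfolding orth_proj_def
proof (rule the_equality)
  show "y \<in> M \<and> (\<forall>m\<in>M. cinner m (x - y) = 0)"
    using assms by blast
next
  fix y' assume y': "y' \<in> M \<and> (\<forall>m\<in>M. cinner m (x - y') = 0)"
  have "y' - y \<in> M"
    using assms(1,2) y' linear_diff[OF bounded_operator_linear[OF isometry_bounded[OF U]]]
    by (auto simp: eigenspace_def scaleC_diff_right)
  then have "cinner (y' - y) (x - y) = 0" "cinner (y' - y) (x - y') = 0"
    using assms(3) y' by blast+
  then have "cinner (y' - y) (y' - y) = 0"
    by (simp add: cinner_diff_right)
  then show "y' = y"
    using cinner_eq_zero_iff[of "y' - y"] by simp
qed

lemmas eigenproj_eqI = orth_proj_eqI[OF refl, folded eigenproj_def]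

lemma
  assumes z: "cmod z = 1"
  shows twisted_cesaro_tendsto: "(\<lambda>N. twisted_cesaro U z N x) \<longlonglongrightarrow> eigenproj U z x"
    and eigenproj_in: "eigenproj U z x \<in> eigenspace U z"
    and eigenproj_orthogonal: "m \<in> eigenspace U z \<Longrightarrow> cinner m (x - eigenproj U z x) = 0"
proof -
  obtain y where y: "(\<lambda>N. twisted_cesaro U z N x) \<longlonglongrightarrow> y" "y \<in> eigenspace U z"
    "\<And>m. m \<in> eigenspace U z \<Longrightarrow> cinner m (x - y) = 0"
    unfolding twisted_cesaro_def eigenspace_iff_fixed[OF z]
    using mean_ergodic[OF isometry_twisted[OF z], of x] by blast
  then have "eigenproj U z x = y"
    by (intro eigenproj_eqI)
  then show "(\<lambda>N. twisted_cesaro U z N x) \<longlonglongrightarrow> eigenproj U z x"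
    "eigenproj U z x \<in> eigenspace U z"
    "m \<in> eigenspace U z \<Longrightarrow> cinner m (x - eigenproj U z x) = 0"
    using y by auto
qed

lemma eigenproj_eigen: "cmod z = 1 \<Longrightarrow> U (eigenproj U z x) = z *\<^sub>C eigenproj U z x"
  using eigenproj_in by (simp add: eigenspace_def)

lemma eigenproj_funpow:
  assumes "cmod z = 1"
  shows "(U ^^ n) (eigenproj U z x) = z ^ n *\<^sub>C eigenproj U z x"
  by (induction n)
    (simp_all add: scaleC_one bounded_operator_scaleC isometry_bounded[OF U] scaleC_scaleC
      eigenproj_eigen[OF assms] mult.commute)

lemma norm_eigenproj_le:
  assumes "cmod z = 1"
  shows "norm (eigenproj U z x) \<le> norm x"
proof (rule LIMSEQ_le_const2[OF tendsto_norm[OF twisted_cesaro_tendsto[OF assms]]])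
  show "\<exists>N. \<forall>n\<ge>N. norm (twisted_cesaro U z n x) \<le> norm x"
    using norm_cesaro_le[OF isometry_twisted[OF assms]] by (simp add: twisted_cesaro_def)
qed

lemma bounded_operator_eigenproj:
  assumes z: "cmod z = 1"
  shows "bounded_operator (eigenproj U z)"
proof (rule bounded_operatorI[where B = 1])
  note lin = bounded_operator_linear[OF cesaro_bounded_operator[OF isometry_twisted[OF z]]]
    and lim = twisted_cesaro_tendsto[OF z]
  show "eigenproj U z (x + y) = eigenproj U z x + eigenproj U z y" for x y
  proof (rule LIMSEQ_unique[OF lim])
    show "(\<lambda>N. twisted_cesaro U z N (x + y)) \<longlonglongrightarrow> eigenproj U z x + eigenproj U z y"
      unfolding twisted_cesaro_def linear_add[OF lin]
      by (intro tendsto_add lim[unfolded twisted_cesaro_def])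
  qed
  show "eigenproj U z (c *\<^sub>C x) = c *\<^sub>C eigenproj U z x" for c x
  proof (rule LIMSEQ_unique[OF lim])
    show "(\<lambda>N. twisted_cesaro U z N (c *\<^sub>C x)) \<longlonglongrightarrow> c *\<^sub>C eigenproj U z x"
      unfolding twisted_cesaro_def
        bounded_operator_scaleC[OF cesaro_bounded_operator[OF isometry_twisted[OF z]]]
      by (intro tendsto_scaleC tendsto_const lim[unfolded twisted_cesaro_def])
  qed
qed (simp add: norm_eigenproj_le z)

lemma eigenspace_orthogonal:
  assumes "cmod z = 1" "cmod w = 1" "z \<noteq> w" "x \<in> eigenspace U z" "y \<in> eigenspace U w"
  shows "cinner x y = 0"
proof -
  have "z * cnj z = 1"
    using complex_norm_square[of z] assms(1) by simp
  then have "cnj z * w \<noteq> 1"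
    using assms(3) by (metis mult.assoc mult.commute mult_1)
  moreover have "cinner x y = cnj z * w * cinner x y"
    using isometry_cinner[OF U, of x y] assms(4,5)
    by (simp add: eigenspace_def cinner_scaleC_left cinner_scaleC_right mult.commute)
  ultimately show ?thesis
    by simp
qed

lemma eigenproj_self:
  assumes "x \<in> eigenspace U z"
  shows "eigenproj U z x = x"
  using assms by (intro eigenproj_eqI) auto

lemma eigenproj_other:
  assumes "cmod z = 1" "cmod w = 1" "z \<noteq> w" "x \<in> eigenspace U w"
  shows "eigenproj U z x = 0"
proof (rule eigenproj_eqI)
  show "0 \<in> eigenspace U z"
    using linear_0[OF bounded_operator_linear[OF isometry_bounded[OF U]]]
    by (simp add: eigenspace_def)
qed (use eigenspace_orthogonal[of z w] assms in auto)

lemma eigenproj_nonzero_sigma_pp: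
  assumes "cmod z = 1" "eigenproj U z x \<noteq> 0"
  shows "z \<in> sigma_pp U"
  unfolding sigma_pp_def using assms eigenproj_eigen[OF assms(1), of x]
  by (intro CollectI conjI exI[of _ "eigenproj U z x"]) auto

lemma eigenproj_bessel:
  assumes F: "finite F" "F \<subseteq> sphere 0 1"
  shows "(\<Sum>z\<in>F. (norm (eigenproj U z x))\<^sup>2) \<le> (norm x)\<^sup>2"
proof -
  let ?P = "\<Sum>z\<in>F. eigenproj U z x"
  have unit: "cmod z = 1" if "z \<in> F" for z
    using F that by auto
  have orth: "cinner (eigenproj U z x) (eigenproj U w x) = 0" if "z \<in> F" "w \<in> F" "z \<noteq> w" for z w
    using that unit by (intro eigenspace_orthogonal[of z w] eigenproj_in) auto
  have "cinner (eigenproj U z x) (x - ?P) = 0" if z: "z \<in> F" for z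
  proof -
    have "cinner (eigenproj U z x) ?P = cinner (eigenproj U z x) (eigenproj U z x)"
      unfolding cinner_sum_right using orth z F(1)
      by (subst sum.remove[of _ z]) (auto intro!: sum.neutral)
    then show ?thesis
      using eigenproj_orthogonal[OF unit[OF z] eigenproj_in[OF unit[OF z]], of x x]
      by (simp add: cinner_diff_right)
  qed
  then have "cinner ?P (x - ?P) = 0"
    by (simp add: cinner_sum_left)
  then have "(norm x)\<^sup>2 = (norm ?P)\<^sup>2 + (norm (x - ?P))\<^sup>2"
    using norm_add_sq[of ?P "x - ?P"] by simp
  moreover have "(norm ?P)\<^sup>2 = (\<Sum>z\<in>F. (norm (eigenproj U z x))\<^sup>2)"
    using orth F(1) by (intro norm_sum_sq_orthogonal)
  ultimately show ?thesis
    by simp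
qed

text \<open>Phases change neither the orthogonality nor the norms of the components, so this is
  Bessel's inequality. In the estimate of the spectral sums these combinations are the contractions
  at the individual positions.\<close>

lemma norm_eigenproj_combination_le:
  assumes F: "finite F" "F \<subseteq> sphere 0 1" and \<theta>: "\<And>z. z \<in> F \<Longrightarrow> cmod (\<theta> z) = 1"
  shows "norm (\<Sum>z\<in>F. \<theta> z *\<^sub>C eigenproj U z x) \<le> norm x"
proof -
  have "(norm (\<Sum>z\<in>F. \<theta> z *\<^sub>C eigenproj U z x))\<^sup>2 = (\<Sum>z\<in>F. (norm (\<theta> z *\<^sub>C eigenproj U z x))\<^sup>2)"
  proof (rule norm_sum_sq_orthogonal[OF F(1)])
    fix z w assume "z \<in> F" "w \<in> F" "z \<noteq> w"
    then have "cinner (eigenproj U z x) (eigenproj U w x) = 0"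
      using F by (intro eigenspace_orthogonal[of z w] eigenproj_in) auto
    then show "cinner (\<theta> z *\<^sub>C eigenproj U z x) (\<theta> w *\<^sub>C eigenproj U w x) = 0"
      by (simp add: cinner_scaleC_left cinner_scaleC_right)
  qed
  also have "\<dots> = (\<Sum>z\<in>F. (norm (eigenproj U z x))\<^sup>2)"
    using \<theta> by (intro sum.cong) (auto simp: norm_scaleC)
  also have "\<dots> \<le> (norm x)\<^sup>2"
    by (rule eigenproj_bessel[OF F])
  finally show ?thesis
    by (rule power2_le_imp_le) simp
qed

text \<open>By Bessel, \<open>n\<close> components above \<open>\<epsilon>\<close> force
  \<open>n * \<epsilon>\<^sup>2 \<le> (norm a)\<^sup>2\<close>. Hence finitely many components are
  to be split off even when there are uncountably many eigenvalues.\<close>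

lemma finite_large_eigenproj:
  assumes "\<epsilon> > 0"
  shows "finite {z \<in> sphere 0 1. norm (eigenproj U z a) > \<epsilon>}" (is "finite ?B")
proof (rule ccontr)
  assume inf: "infinite ?B"
  obtain n :: nat where n: "(norm a)\<^sup>2 < n * \<epsilon>\<^sup>2"
    using reals_Archimedean3[of "\<epsilon>\<^sup>2"] assms by (meson zero_less_power)
  obtain F where F: "F \<subseteq> ?B" "card F = n" "finite F"
    using infinite_arbitrarily_large[OF inf, of n] by blast
  have "n * \<epsilon>\<^sup>2 = (\<Sum>z\<in>F. \<epsilon>\<^sup>2)"
    using F by simp
  also have "\<dots> \<le> (\<Sum>z\<in>F. (norm (eigenproj U z a))\<^sup>2)"
    using F assms by (intro sum_mono power_mono) auto
  also have "\<dots> \<le> (norm a)\<^sup>2"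
    using F by (intro eigenproj_bessel) auto
  finally show False
    using n by simp
qed

end

section \<open>Uniform decay of twisted averages\<close>

text \<open>The norms of the partial sums \<open>s\<close> are subadditive, because
  \<open>V ^^ m\<close> is isometric. Dividing \<open>N\<close> by \<open>p\<close> with remainder,
  the full blocks contribute at most \<open>N * \<delta>\<close>, the incomplete one fewer than
  \<open>p\<close> vectors of norm \<open>norm a\<close>.\<close>

lemma norm_cesaro_le_multiple:
  assumes V: "isometry_operator V" and p: "p > 0" "norm (cesaro V p a) \<le> \<delta>"
    and N: "N > 0"
  shows "norm (cesaro V N a) \<le> \<delta> + p * norm a / N"
proof -
  define s where "s m = (\<Sum>n<m. (V ^^ n) a)" for m
  have cesaro: "cesaro V m a = (1 / real m) *\<^sub>R s m" for m
    by (simp add: cesaro_def s_def)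
  have add: "s (m + n) = s m + (V ^^ m) (s n)" for m n
  proof -
    have "s (m + n) = s m + (\<Sum>i<n. (V ^^ (m + i)) a)"
      unfolding s_def by (induction n) (simp_all add: add.assoc)
    then show ?thesis
      by (simp add: s_def funpow_add linear_sum[OF isometry_pow_linear[OF V]])
  qed
  have add_le: "norm (s (m + n)) \<le> norm (s m) + norm (s n)" for m n
    using norm_triangle_ineq[of "s m" "(V ^^ m) (s n)"] by (simp add: add isometry_pow_norm[OF V])
  have triv: "norm (s m) \<le> m * norm a" for m
    using sum_norm_bound[of "{..<m}" "\<lambda>n. (V ^^ n) a" "norm a"]
    by (simp add: s_def isometry_pow_norm[OF V])
  have sp: "norm (s p) \<le> p * \<delta>"
    using p by (simp add: cesaro field_simps)
  have mult: "norm (s (q * p)) \<le> q * (p * \<delta>)" for q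
  proof (induction q)
    case (Suc q)
    then show ?case
      using add_le[of p "q * p"] sp by (simp add: algebra_simps)
  qed (simp add: s_def)
  have "0 \<le> \<delta>"
    using p(2) norm_ge_zero order_trans by blast
  have "norm (s N) \<le> norm (s (N div p * p)) + norm (s (N mod p))"
    using add_le[of "N div p * p" "N mod p"] by simp
  also have "\<dots> \<le> real (N div p * p) * \<delta> + real (N mod p) * norm a"
    using mult[of "N div p"] triv[of "N mod p"] by (simp add: mult.assoc)
  also have "\<dots> \<le> real N * \<delta> + real p * norm a"
    using p \<open>0 \<le> \<delta>\<close> by (intro add_mono mult_right_mono) (auto simp flip: of_nat_mult)
  finally show ?thesis
    using N by (simp add: cesaro field_simps)
qed

lemma twisted_cesaro_eq:
  assumes "isometry_operator U"
  shows "twisted_cesaro U z N x = (1 / real N) *\<^sub>R (\<Sum>n<N. cnj z ^ n *\<^sub>C (U ^^ n) x)"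
  by (simp add: twisted_cesaro_def cesaro_def isometry_scaled_funpow[OF assms])

text \<open>The inequality \<open>norm (cesaro V N a) \<le> \<delta> + p * norm a / N\<close> propagates smallness of one average
  to all later ones, uniformly in a neighbourhood of \<open>z\<close>; compactness of the circle does the rest.\<close>

lemma twisted_cesaro_uniformly_small:
  fixes U :: "'a::chilbert_space \<Rightarrow> 'a"
  assumes U: "isometry_operator U" and \<epsilon>: "\<epsilon> > 0"
    and small: "\<And>z. cmod z = 1 \<Longrightarrow> norm (eigenproj U z a) \<le> \<epsilon>"
  shows "\<forall>\<^sub>F N in sequentially. \<forall>z. cmod z = 1 \<longrightarrow> norm (twisted_cesaro U z N a) \<le> 3 * \<epsilon>"
proof -
  define O' where "O' p = {z. norm (twisted_cesaro U z p a) < 2 * \<epsilon>}" for p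
  have "open (O' p)" for p
  proof -
    have "continuous_on UNIV (\<lambda>z. norm (twisted_cesaro U z p a))"
      unfolding twisted_cesaro_eq[OF U]
      by (intro continuous_intros bounded_bilinear.continuous_on[OF bounded_bilinear_scaleC])
    then show ?thesis
      unfolding O'_def by (intro open_Collect_less) (auto intro: continuous_on_const)
  qed
  \<comment> \<open>The index \<open>0\<close> is excluded, since the empty average vanishes and
    \<open>O' 0\<close> would be the whole plane. The threshold \<open>2 * \<epsilon>\<close> lies
    strictly above the limit of the norms, which is at most \<open>\<epsilon>\<close>.\<close>
  moreover have "sphere 0 1 \<subseteq> (\<Union>p\<in>{1..}. O' p)"
  proof
    fix z :: complex assume "z \<in> sphere 0 1"
    then have z: "cmod z = 1"
      by simp
    have "norm (eigenproj U z a) < 2 * \<epsilon>"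
      using small[OF z] \<epsilon> by linarith
    then have "\<forall>\<^sub>F p in sequentially. norm (twisted_cesaro U z p a) < 2 * \<epsilon>"
      using order_tendstoD(2)[OF tendsto_norm[OF twisted_cesaro_tendsto[OF U z]]] by blast
    then obtain M where "\<And>p. p \<ge> M \<Longrightarrow> norm (twisted_cesaro U z p a) < 2 * \<epsilon>"
      by (auto simp: eventually_sequentially)
    then show "z \<in> (\<Union>p\<in>{1..}. O' p)"
      unfolding O'_def by (intro UN_I[of "max 1 M"]) auto
  qed
  ultimately obtain D where D: "D \<subseteq> {1..}" "finite D" "sphere 0 1 \<subseteq> (\<Union>p\<in>D. O' p)"
    using compactE_image[OF compact_sphere] by metis
  \<comment> \<open>One bound for all lengths \<open>p\<close> of the finite subcover makes the
    error \<open>p * norm a / N\<close> uniform in \<open>z\<close>; \<open>M\<close> is then chosen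
    so that it is at most \<open>\<epsilon>\<close>, which gives \<open>3 * \<epsilon>\<close> in
    total.\<close>
  define P where "P = Max (insert 1 D)"
  have P: "p \<le> P" if "p \<in> D" for p
    using that D(2) by (simp add: P_def)
  obtain M :: nat where M: "real P * norm a / \<epsilon> < M"
    using reals_Archimedean2 by blast
  show ?thesis
  proof (rule eventually_sequentiallyI[of "max 1 M"], intro allI impI)
    fix N and z :: complex assume N: "max 1 M \<le> N" and z: "cmod z = 1"
    then obtain p where p: "p \<in> D" "norm (twisted_cesaro U z p a) < 2 * \<epsilon>"
      using D(3) unfolding O'_def by (force simp: subset_iff)
    have "norm (twisted_cesaro U z N a) \<le> 2 * \<epsilon> + p * norm a / N"
      using p D(1) N unfolding twisted_cesaro_def
      by (intro norm_cesaro_le_multiple isometry_twisted U z) auto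
    moreover have "p * norm a / N \<le> \<epsilon>"
    proof -
      have "p * norm a \<le> P * norm a"
        using P[OF p(1)] by (intro mult_right_mono) auto
      also have "\<dots> \<le> M * \<epsilon>"
        using M \<epsilon> by (simp add: field_simps)
      also have "\<dots> \<le> N * \<epsilon>"
        using N \<epsilon> by (intro mult_right_mono) auto
      finally show ?thesis
        using N by (simp add: field_simps)
    qed
    ultimately show "norm (twisted_cesaro U z N a) \<le> 3 * \<epsilon>"
      by linarith
  qed
qed

section \<open>Discrete Fourier transform\<close>

definition unity_root :: "nat \<Rightarrow> complex" where
  "unity_root L = cis (2 * pi / L)"

lemma norm_unity_root_pow [simp]: "cmod (unity_root L ^ n) = 1"
  by (simp add: unity_root_def norm_power)

text \<open>Off the diagonal this is a geometric sum with ratio \<open>q\<close>, where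
  \<open>q ^ L = 1\<close> and \<open>q \<noteq> 1\<close>, because distinct exponents below
  \<open>L\<close> give distinct roots.\<close>

lemma unity_root_orthogonality:
  assumes "m < L" "n < L"
  shows "(\<Sum>t<L. unity_root L ^ (t * m) * cnj (unity_root L ^ (t * n))) = (if m = n then of_nat L else 0)"
proof -
  define q where "q = unity_root L ^ m * cnj (unity_root L ^ n)"
  have L: "L > 0"
    using assms by simp
  have cis: "unity_root L ^ j = cis (2 * pi * real j / real L)" for j
    by (simp add: unity_root_def Complex.DeMoivre mult_ac)
  have unit: "unity_root L ^ j * cnj (unity_root L ^ j) = 1" for j
    using complex_norm_square[of "unity_root L ^ j"] by simp
  have summand: "unity_root L ^ (t * m) * cnj (unity_root L ^ (t * n)) = q ^ t" for t
    by (simp add: q_def power_mult_distrib mult.commute[of t] flip: power_mult)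
  show ?thesis
  proof (cases "m = n")
    case True
    then show ?thesis
      using unit by (simp add: summand q_def)
  next
    case False
    have "q \<noteq> 1"
    proof
      assume "q = 1"
      then have "unity_root L ^ m * (cnj (unity_root L ^ n) * unity_root L ^ n) = unity_root L ^ n"
        unfolding q_def by (metis mult.assoc mult_1)
      then have "unity_root L ^ m = unity_root L ^ n"
        using unit[of n] by (metis mult.commute mult_1_right)
      then show False
        using bij_betw_imp_inj_on[OF Complex.bij_betw_roots_unity[OF L]] assms False
        by (auto simp: inj_on_def cis)
    qed
    moreover have "unity_root L ^ L = 1"
      using L by (simp add: cis)
    then have "q ^ L = 1"
      unfolding q_def power_mult_distrib by (metis complex_cnj_one complex_cnj_power mult.commute
          mult_1 power_mult power_one)
    ultimately show ?thesis
      unfolding summand using False by (simp add: geometric_sum)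
  qed
qed

text \<open>Expanding the squared norms, orthogonality of the characters cancels all cross terms
  after summation over \<open>t\<close>. The vector-valued form is applied to
  \<open>C r *\<^sub>C s r\<close> and also to scalars carried by a fixed vector.\<close>

lemma parseval:
  fixes v :: "nat \<Rightarrow> 'a::complex_inner"
  shows "(\<Sum>t<L. (norm (\<Sum>r<L. unity_root L ^ (t * r) *\<^sub>C v r))\<^sup>2) = L * (\<Sum>r<L. (norm (v r))\<^sup>2)"
proof -
  let ?w = "\<lambda>t r. unity_root L ^ (t * r)"
  have "complex_of_real (\<Sum>t<L. (norm (\<Sum>r<L. ?w t r *\<^sub>C v r))\<^sup>2) =
      (\<Sum>t<L. \<Sum>r<L. \<Sum>s<L. (?w t s * cnj (?w t r)) * cinner (v r) (v s))"
    unfolding of_real_sum cinner_self[symmetric] cinner_sum_left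
    unfolding cinner_sum_right
    by (simp add: cinner_scaleC_left cinner_scaleC_right mult_ac)
  also have "\<dots> = (\<Sum>r<L. \<Sum>s<L. (\<Sum>t<L. ?w t s * cnj (?w t r)) * cinner (v r) (v s))"
    by (subst sum.swap, rule sum.cong[OF refl], subst sum.swap) (simp add: sum_distrib_right)
  also have "\<dots> = (\<Sum>r<L. \<Sum>s<L. if s = r then of_nat L * cinner (v r) (v s) else 0)"
    by (intro sum.cong refl) (subst unity_root_orthogonality, auto)
  also have "\<dots> = complex_of_real (L * (\<Sum>r<L. (norm (v r))\<^sup>2))"
    by (simp add: sum.delta cinner_self sum_distrib_left)
  finally show ?thesis
    by (simp only: of_real_eq_iff)
qed

text \<open>The orbit vectors are recovered from the twisted averages \<open>s r\<close> at the \<open>2 * N\<close>-th roots of unity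
  by Fourier inversion. Translating the combination by \<open>U ^^ t\<close> for the \<open>N\<close> values \<open>t < N\<close> keeps its norm,
  and summing the squares over \<open>t\<close> makes Parseval's identity applicable.\<close>

lemma norm_orbit_combination_le:
  fixes U :: "'a::complex_inner \<Rightarrow> 'a"
  assumes U: "isometry_operator U" and N: "N > 0"
    and K: "\<And>z. cmod z = 1 \<Longrightarrow> norm (twisted_cesaro U z (2 * N) a) \<le> K"
  shows "(norm ((1 / real N) *\<^sub>R (\<Sum>n<N. c n *\<^sub>C (U ^^ n) a)))\<^sup>2 \<le> 4 * K\<^sup>2 * ((\<Sum>n<N. (cmod (c n))\<^sup>2) / N)"
proof -
  \<comment> \<open>Twice \<open>N\<close>, so that a translated index \<open>t + n\<close> with
    \<open>t\<close> and \<open>n\<close> below \<open>N\<close> stays below \<open>L\<close> and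
    inversion applies to it without wrapping around.\<close>
  define L where "L = 2 * N"
  define s where "s r = (\<Sum>n<L. cnj (unity_root L ^ r) ^ n *\<^sub>C (U ^^ n) a)" for r
  define C where "C r = (\<Sum>n<N. c n * unity_root L ^ (r * n))" for r
  define w where "w = (\<Sum>n<N. c n *\<^sub>C (U ^^ n) a)"
  have L: "L > 0" "N < L"
    using N by (simp_all add: L_def)
  have s_le: "norm (s r) \<le> L * K" for r
  proof -
    have "norm ((1 / real L) *\<^sub>R s r) \<le> K"
      using K[of "unity_root L ^ r"] twisted_cesaro_eq[OF U] by (simp add: L_def s_def)
    then show ?thesis
      using L by (simp add: field_simps)
  qed
  have inversion: "(\<Sum>r<L. unity_root L ^ (r * m) *\<^sub>C s r) = of_nat L *\<^sub>C (U ^^ m) a" if m: "m < L" for m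
  proof -
    have "(\<Sum>r<L. unity_root L ^ (r * m) *\<^sub>C s r) =
        (\<Sum>n<L. (\<Sum>r<L. unity_root L ^ (r * m) * cnj (unity_root L ^ (r * n))) *\<^sub>C (U ^^ n) a)"
      unfolding s_def scaleC_sum_right scaleC_sum_left
      by (subst sum.swap) (simp add: scaleC_scaleC power_mult)
    also have "\<dots> = (\<Sum>n<L. if n = m then of_nat L *\<^sub>C (U ^^ n) a else 0)"
      using m by (intro sum.cong refl) (subst unity_root_orthogonality, auto)
    also have "\<dots> = of_nat L *\<^sub>C (U ^^ m) a"
      using m by (simp add: sum.delta)
    finally show ?thesis .
  qed
  have translate: "of_nat L *\<^sub>C (U ^^ t) w = (\<Sum>r<L. unity_root L ^ (t * r) *\<^sub>C (C r *\<^sub>C s r))"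
    if t: "t < N" for t
  proof -
    have "(U ^^ t) w = (\<Sum>n<N. c n *\<^sub>C (U ^^ (t + n)) a)"
      unfolding w_def linear_sum[OF isometry_pow_linear[OF U]] funpow_add
      by (simp add: bounded_operator_scaleC[OF isometry_bounded[OF isometry_funpow[OF U]]])
    then have "of_nat L *\<^sub>C (U ^^ t) w = (\<Sum>n<N. c n *\<^sub>C (of_nat L *\<^sub>C (U ^^ (t + n)) a))"
      by (simp add: scaleC_sum_right scaleC_scaleC mult.commute)
    also have "\<dots> = (\<Sum>n<N. c n *\<^sub>C (\<Sum>r<L. unity_root L ^ (r * (t + n)) *\<^sub>C s r))"
      using t by (intro sum.cong refl) (subst inversion, auto simp: L_def)
    also have "\<dots> = (\<Sum>r<L. \<Sum>n<N. (c n * unity_root L ^ (r * (t + n))) *\<^sub>C s r)"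
      unfolding scaleC_sum_right scaleC_scaleC by (rule sum.swap)
    also have "\<dots> = (\<Sum>r<L. unity_root L ^ (t * r) *\<^sub>C (C r *\<^sub>C s r))"
      unfolding C_def scaleC_scaleC
      by (simp add: scaleC_sum_left[symmetric] sum_distrib_left distrib_left power_add mult_ac)
    finally show ?thesis .
  qed
  \<comment> \<open>The scalars \<open>c n\<close> are padded by zeros up to \<open>L\<close> and
    multiplied by \<open>a\<close> to bring them under \<open>parseval\<close>; cancelling
    \<open>norm a\<close> afterwards uses \<open>a \<noteq> 0\<close>.\<close>
  have C_sum: "(\<Sum>r<L. (cmod (C r))\<^sup>2) = L * (\<Sum>n<N. (cmod (c n))\<^sup>2)" if "a \<noteq> 0"
  proof -
    let ?v = "\<lambda>n. (if n < N then c n else 0) *\<^sub>C a"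
    have "C r *\<^sub>C a = (\<Sum>n<L. unity_root L ^ (r * n) *\<^sub>C ?v n)" for r
      unfolding C_def scaleC_sum_left using L
      by (intro sum.mono_neutral_cong_left) (auto simp: scaleC_scaleC mult.commute)
    then have "(\<Sum>r<L. (norm (C r *\<^sub>C a))\<^sup>2) = L * (\<Sum>n<L. (norm (?v n))\<^sup>2)"
      by (simp only: parseval)
    also have "(\<Sum>n<L. (norm (?v n))\<^sup>2) = (\<Sum>n<N. (norm (c n *\<^sub>C a))\<^sup>2)"
      using L by (intro sum.mono_neutral_cong_right) auto
    finally show ?thesis
      using that by (simp add: norm_scaleC power_mult_distrib flip: sum_distrib_right)
  qed
  have "N * (real L)\<^sup>2 * (norm w)\<^sup>2 = (\<Sum>t<N. (norm (of_nat L *\<^sub>C (U ^^ t) w))\<^sup>2)"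
    by (simp add: norm_scaleC isometry_pow_norm[OF U] power_mult_distrib)
  also have "\<dots> = (\<Sum>t<N. (norm (\<Sum>r<L. unity_root L ^ (t * r) *\<^sub>C (C r *\<^sub>C s r)))\<^sup>2)"
    by (simp add: translate)
  \<comment> \<open>\<open>translate\<close> covers only \<open>t < N\<close>, but its right-hand
    side makes sense for all \<open>t < L\<close>; adding these nonnegative terms completes the
    Fourier sum.\<close>
  also have "\<dots> \<le> (\<Sum>t<L. (norm (\<Sum>r<L. unity_root L ^ (t * r) *\<^sub>C (C r *\<^sub>C s r)))\<^sup>2)"
    using L by (intro sum_mono2) auto
  also have "\<dots> = L * (\<Sum>r<L. (cmod (C r))\<^sup>2 * (norm (s r))\<^sup>2)"
    by (simp add: parseval norm_scaleC power_mult_distrib)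
  also have "\<dots> \<le> L * (\<Sum>r<L. (cmod (C r))\<^sup>2 * (L * K)\<^sup>2)"
    using s_le by (intro mult_left_mono sum_mono power_mono) auto
  also have "\<dots> = L * (L * K)\<^sup>2 * (\<Sum>r<L. (cmod (C r))\<^sup>2)"
    by (simp add: mult_ac flip: sum_distrib_right)
  finally have main: "N * (real L)\<^sup>2 * (norm w)\<^sup>2 \<le> L * (L * K)\<^sup>2 * (\<Sum>r<L. (cmod (C r))\<^sup>2)" .
  have w_le: "N * (norm w)\<^sup>2 \<le> (real L)\<^sup>2 * K\<^sup>2 * (\<Sum>n<N. (cmod (c n))\<^sup>2)"
  proof (cases "a = 0")
    case True
    then have "w = 0"
      by (simp add: w_def linear_0[OF isometry_pow_linear[OF U]])
    then show ?thesis
      by (simp add: sum_nonneg)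
  next
    case False
    have "(real L)\<^sup>2 * (N * (norm w)\<^sup>2) \<le> (real L)\<^sup>2 * ((real L)\<^sup>2 * K\<^sup>2 * (\<Sum>n<N. (cmod (c n))\<^sup>2))"
      using main unfolding C_sum[OF False] by (simp add: power2_eq_square mult_ac)
    then show ?thesis
      using L by (simp add: mult_le_cancel_left_pos)
  qed
  have "(norm ((1 / real N) *\<^sub>R w))\<^sup>2 = N * (norm w)\<^sup>2 / N ^ 3"
    using N by (simp add: power_mult_distrib power_divide power2_eq_square power3_eq_cube)
  also have "\<dots> \<le> (real L)\<^sup>2 * K\<^sup>2 * (\<Sum>n<N. (cmod (c n))\<^sup>2) / N ^ 3"
    using w_le by (intro divide_right_mono) auto
  \<comment> \<open>The factor \<open>4\<close> is the square of \<open>L / N\<close>.\<close>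
  also have "\<dots> = 4 * K\<^sup>2 * ((\<Sum>n<N. (cmod (c n))\<^sup>2) / N)"
    using N by (simp add: L_def power2_eq_square power3_eq_cube)
  finally show ?thesis
    by (simp add: w_def)
qed

section \<open>A Wiener lemma for orbit correlations\<close>

text \<open>Functionals rather than representing vectors: rank one operators then have the form
  \<open>f x *\<^sub>C e\<close>, and the test functional \<open>cinner y\<close> stands on the same
  footing as the \<open>f j\<close>.\<close>

definition bounded_functional :: "('a::complex_inner \<Rightarrow> complex) \<Rightarrow> bool" where
  "bounded_functional g \<longleftrightarrow> (\<forall>x y. g (x + y) = g x + g y) \<and> (\<forall>c x. g (c *\<^sub>C x) = c * g x) \<and>
     (\<exists>B. \<forall>x. cmod (g x) \<le> B * norm x)"

lemma bounded_functional_scaleC: "bounded_functional g \<Longrightarrow> g (c *\<^sub>C x) = c * g x"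
  by (simp add: bounded_functional_def)

lemma bounded_functional_linear:
  assumes "bounded_functional g"
  shows "bounded_linear g"
proof -
  obtain B where B: "\<And>x. cmod (g x) \<le> B * norm x" and "\<And>x y. g (x + y) = g x + g y"
    "\<And>c x. g (c *\<^sub>C x) = c * g x"
    using assms unfolding bounded_functional_def by blast
  then show ?thesis
    by (intro bounded_linear_intro[where K = B])
      (simp_all add: scaleR_scaleC scaleR_conv_of_real mult.commute[of _ B])
qed

lemmas bounded_functional_tendsto = bounded_linear.tendsto[OF bounded_functional_linear]
  and bounded_functional_sum = linear_sum[OF bounded_linear.linear[OF bounded_functional_linear]]
  and bounded_functional_scaleR = linear_scale[OF bounded_linear.linear[OF bounded_functional_linear]]
  and bounded_functional_zero = linear_0[OF bounded_linear.linear[OF bounded_functional_linear]]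

lemma bounded_functional_cinner:
  assumes "bounded_operator T"
  shows "bounded_functional (\<lambda>x. cinner y (T x))"
proof -
  obtain B where B: "B \<ge> 0" "\<And>x. norm (T x) \<le> B * norm x"
    using bounded_operator_bound[OF assms] by blast
  have "cmod (cinner y (T x)) \<le> norm y * B * norm x" for x
    using norm_cinner_le[of y "T x"] mult_left_mono[OF B(2)[of x], of "norm y"]
    by (simp add: mult.assoc)
  then show ?thesis
    unfolding bounded_functional_def
    by (intro conjI exI[of _ "norm y * B"])
      (auto simp: linear_add[OF bounded_operator_linear[OF assms]] bounded_operator_scaleC[OF assms]
        cinner_add_right cinner_scaleC_right)
qed

text \<open>The contribution of one pair of positions once all operators have rank one: the later
  position feeds \<open>b\<close> into the functional of the operator to its left, the earlier one
  acts on \<open>a\<close>.\<close>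

definition orbit_correlation ::
  "('a::complex_inner \<Rightarrow> 'a) \<Rightarrow> ('a \<Rightarrow> complex) \<Rightarrow> 'a \<Rightarrow> 'a \<Rightarrow> nat \<Rightarrow> 'a" where
  "orbit_correlation U g a b N = (1 / real N) *\<^sub>R (\<Sum>n<N. g ((U ^^ n) b) *\<^sub>C (U ^^ n) a)"

definition spectral_correlation ::
  "('a::complex_inner \<Rightarrow> 'a) \<Rightarrow> ('a \<Rightarrow> complex) \<Rightarrow> 'a \<Rightarrow> 'a \<Rightarrow> complex set \<Rightarrow> 'a" where
  "spectral_correlation U g a b F = (\<Sum>z\<in>F. g (eigenproj U (cnj z) b) *\<^sub>C eigenproj U z a)"

context
  fixes U :: "'a::chilbert_space \<Rightarrow> 'a" and g :: "'a \<Rightarrow> complex"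
  assumes U: "isometry_operator U" and g: "bounded_functional g"
begin

text \<open>On the component of \<open>a\<close> at \<open>z\<close> the operator
  \<open>U ^^ n\<close> acts as the scalar \<open>z ^ n\<close>. This phase moves into the argument
  of \<open>g\<close>, where it produces the twisted average of \<open>b\<close> at
  \<open>cnj z\<close>; this is the origin of the conjugate in the spectral sums.\<close>

lemma orbit_correlation_eigenvectors:
  assumes F: "finite F" "F \<subseteq> sphere 0 1"
  shows "orbit_correlation U g (\<Sum>z\<in>F. eigenproj U z a) b \<longlonglongrightarrow> spectral_correlation U g a b F"
proof -
  note lin = isometry_pow_linear[OF U]
  have unit: "cmod z = 1" if "z \<in> F" for z
    using F that by auto
  have "orbit_correlation U g (\<Sum>z\<in>F. eigenproj U z a) b =
      (\<lambda>N. \<Sum>z\<in>F. g (twisted_cesaro U (cnj z) N b) *\<^sub>C eigenproj U z a)"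
  proof
    fix N
    have pull: "g (r *\<^sub>R x) *\<^sub>C v = r *\<^sub>R (g x *\<^sub>C v)" for r x v
      by (simp add: scaleR_scaleC bounded_functional_scaleC[OF g] scaleC_scaleC)
    have "(\<Sum>n<N. g ((U ^^ n) b) *\<^sub>C (U ^^ n) (\<Sum>z\<in>F. eigenproj U z a)) =
        (\<Sum>n<N. \<Sum>z\<in>F. g (z ^ n *\<^sub>C (U ^^ n) b) *\<^sub>C eigenproj U z a)"
      by (intro sum.cong refl)
        (simp add: linear_sum[OF lin] eigenproj_funpow[OF U] unit scaleC_sum_right
          bounded_functional_scaleC[OF g] scaleC_scaleC mult.commute)
    also have "\<dots> = (\<Sum>z\<in>F. g (\<Sum>n<N. z ^ n *\<^sub>C (U ^^ n) b) *\<^sub>C eigenproj U z a)"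
      by (subst sum.swap) (simp add: scaleC_sum_left bounded_functional_sum[OF g])
    finally show "orbit_correlation U g (\<Sum>z\<in>F. eigenproj U z a) b N =
      (\<Sum>z\<in>F. g (twisted_cesaro U (cnj z) N b) *\<^sub>C eigenproj U z a)"
      by (simp add: orbit_correlation_def twisted_cesaro_eq[OF U] pull flip: scaleR_sum_right)
  qed
  moreover have "(\<lambda>N. \<Sum>z\<in>F. g (twisted_cesaro U (cnj z) N b) *\<^sub>C eigenproj U z a)
      \<longlonglongrightarrow> spectral_correlation U g a b F"
    unfolding spectral_correlation_def
    by (intro tendsto_sum tendsto_scaleC tendsto_const bounded_functional_tendsto[OF g]
        twisted_cesaro_tendsto[OF U]) (simp add: unit)
  ultimately show ?thesis
    by simp
qed

lemma orbit_correlation_small: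
  assumes \<epsilon>: "\<epsilon> > 0" and small: "\<And>z. cmod z = 1 \<Longrightarrow> norm (eigenproj U z a) \<le> \<epsilon>"
    and G: "\<And>n. cmod (g ((U ^^ n) b)) \<le> G"
  shows "\<forall>\<^sub>F N in sequentially. norm (orbit_correlation U g a b N) \<le> 6 * \<epsilon> * G"
proof -
  obtain M where M: "\<And>N z. N \<ge> M \<Longrightarrow> cmod z = 1 \<Longrightarrow> norm (twisted_cesaro U z N a) \<le> 3 * \<epsilon>"
    using twisted_cesaro_uniformly_small[OF U \<epsilon> small] unfolding eventually_sequentially
    by (metis (no_types))
  have G0: "G \<ge> 0"
    using G[of 0] norm_ge_zero order_trans by blast
  show ?thesis
  proof (rule eventually_sequentiallyI[of "max 1 M"])
    fix N assume N: "max 1 M \<le> N"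
    have "(norm (orbit_correlation U g a b N))\<^sup>2 \<le> 4 * (3 * \<epsilon>)\<^sup>2 * ((\<Sum>n<N. (cmod (g ((U ^^ n) b)))\<^sup>2) / N)"
      unfolding orbit_correlation_def
    proof (rule norm_orbit_combination_le[OF U])
      show "norm (twisted_cesaro U z (2 * N) a) \<le> 3 * \<epsilon>" if "cmod z = 1" for z
        using N that by (intro M) auto
    qed (use N in simp)
    also have "\<dots> \<le> 4 * (3 * \<epsilon>)\<^sup>2 * ((\<Sum>n<N. G\<^sup>2) / N)"
      by (intro mult_left_mono divide_right_mono sum_mono power_mono G) simp_all
    \<comment> \<open>The constant \<open>6\<close> is \<open>2 * 3\<close>: the \<open>2\<close>
      comes from doubling \<open>N\<close> in the Fourier estimate, the \<open>3\<close> from the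
      uniform bound on twisted averages.\<close>
    also have "\<dots> = (6 * \<epsilon> * G)\<^sup>2"
      using N by (simp add: power_mult_distrib)
    finally show "norm (orbit_correlation U g a b N) \<le> 6 * \<epsilon> * G"
      by (rule power2_le_imp_le) (use \<epsilon> G0 in simp)
  qed
qed

text \<open>Only \<open>a\<close> is decomposed. Its part in the eigenspaces over \<open>F\<close>
  contributes an error \<open>\<epsilon> * G\<close> by convergence, the remainder
  \<open>6 * \<epsilon> * G\<close> by the uniform bound, hence the \<open>7\<close>.\<close>

lemma orbit_correlation_near_spectral:
  assumes \<epsilon>: "\<epsilon> > 0" and F: "finite F" "F \<subseteq> sphere 0 1"
    and small: "\<And>z. cmod z = 1 \<Longrightarrow> z \<notin> F \<Longrightarrow> norm (eigenproj U z a) \<le> \<epsilon>"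
    and G: "\<And>n. cmod (g ((U ^^ n) b)) \<le> G" "G > 0"
  shows "\<forall>\<^sub>F N in sequentially. norm (orbit_correlation U g a b N - spectral_correlation U g a b F) \<le> 7 * \<epsilon> * G"
proof -
  note lin = isometry_pow_linear[OF U]
  define p where "p = (\<Sum>z\<in>F. eigenproj U z a)"
  have "norm (eigenproj U z (a - p)) \<le> \<epsilon>" if z: "cmod z = 1" for z
  proof -
    note plin = bounded_operator_linear[OF bounded_operator_eigenproj[OF U z]]
    \<comment> \<open>Eigenprojections for different values annihilate each other, so subtracting
      \<open>p\<close> deletes exactly the components over \<open>F\<close> and leaves the others
      untouched.\<close>
    have "eigenproj U z (eigenproj U w a) = (if w = z then eigenproj U z a else 0)" if "w \<in> F" for w
    proof -
      have "cmod w = 1"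
        using that F by auto
      then show ?thesis
        using z eigenproj_self[OF U eigenproj_in[OF U z]]
          eigenproj_other[OF U z _ _ eigenproj_in[OF U]] by auto
    qed
    then have "eigenproj U z p = (\<Sum>w\<in>F. if w = z then eigenproj U z a else 0)"
      unfolding p_def linear_sum[OF plin] by (rule sum.cong[OF refl])
    then have "eigenproj U z (a - p) = (if z \<in> F then 0 else eigenproj U z a)"
      using F(1) by (simp add: linear_diff[OF plin])
    then show ?thesis
      using small[OF z] \<epsilon> by auto
  qed
  then have "\<forall>\<^sub>F N in sequentially. norm (orbit_correlation U g (a - p) b N) \<le> 6 * \<epsilon> * G"
    by (intro orbit_correlation_small \<epsilon> G(1))
  moreover have "\<forall>\<^sub>F N in sequentially.
      dist (orbit_correlation U g p b N) (spectral_correlation U g a b F) < \<epsilon> * G"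
    using tendstoD[OF orbit_correlation_eigenvectors[OF F, of a b], of "\<epsilon> * G"] \<epsilon> G(2)
    by (simp add: p_def)
  ultimately show ?thesis
  proof eventually_elim
    case (elim N)
    have "orbit_correlation U g a b N = orbit_correlation U g (a - p) b N + orbit_correlation U g p b N"
      by (simp add: orbit_correlation_def linear_diff[OF lin] scaleC_diff_right sum_subtractf
          flip: scaleR_add_right)
    then show ?case
      using elim norm_triangle_ineq[of "orbit_correlation U g (a - p) b N"
          "orbit_correlation U g p b N - spectral_correlation U g a b F"]
      by (simp add: dist_norm algebra_simps)
  qed
qed

text \<open>A term survives only if \<open>z\<close> and \<open>cnj z\<close> are both eigenvalues,
  and \<open>cnj z\<close> is the inverse of \<open>z\<close>: this is the condition defining
  \<open>sigma_pp_a\<close>. Sets inside \<open>sigma_pp_a U\<close> can thus be compared with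
  larger ones that contain all large components of \<open>a\<close>.\<close>

lemma spectral_correlation_restrict:
  assumes "finite F" "F \<subseteq> sphere 0 1"
  shows "spectral_correlation U g a b F = spectral_correlation U g a b (F \<inter> sigma_pp_a U)"
  unfolding spectral_correlation_def
proof (rule sum.mono_neutral_right)
  show "\<forall>z\<in>F - F \<inter> sigma_pp_a U. g (eigenproj U (cnj z) b) *\<^sub>C eigenproj U z a = 0"
  proof
    fix z assume z: "z \<in> F - F \<inter> sigma_pp_a U"
    then have unit: "cmod z = 1" "cmod (cnj z) = 1"
      using assms by auto
    have "z * cnj z = 1"
      using complex_norm_square[of z] unit by simp
    then have "z \<notin> sigma_pp U \<or> cnj z \<notin> sigma_pp U"
      using z by (auto simp: sigma_pp_a_def)
    then have "eigenproj U z a = 0 \<or> eigenproj U (cnj z) b = 0"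
      using eigenproj_nonzero_sigma_pp[OF U] unit by blast
    then show "g (eigenproj U (cnj z) b) *\<^sub>C eigenproj U z a = 0"
      using bounded_functional_zero[OF g] by auto
  qed
qed (use assms in auto)

text \<open>For every \<open>F\<close> beyond some \<open>F0\<close> the orbit averages are
  eventually close to the spectral sum over \<open>F\<close>, with a threshold on \<open>N\<close>
  that may depend on \<open>F\<close>. The single set \<open>F0\<close> makes the averages Cauchy;
  letting \<open>N\<close> grow for fixed \<open>F\<close> then shows that the net has the same
  limit.\<close>

theorem correlation_limit:
  obtains l where "orbit_correlation U g a b \<longlonglongrightarrow> l"
    "(spectral_correlation U g a b \<longlongrightarrow> l) (finite_subsets_at_top (sigma_pp_a U))"
proof -
  obtain B where B: "\<And>x. cmod (g x) \<le> B * norm x"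
    using g unfolding bounded_functional_def by blast
  define G where "G = \<bar>B * norm b\<bar> + 1"
  have G: "cmod (g ((U ^^ n) b)) \<le> G" "G > 0" for n
    using B[of "(U ^^ n) b"] by (auto simp: G_def isometry_pow_norm[OF U])
  have near: "\<exists>F0. finite F0 \<and> F0 \<subseteq> sigma_pp_a U \<and> (\<forall>F. finite F \<and> F0 \<subseteq> F \<and> F \<subseteq> sigma_pp_a U \<longrightarrow>
      (\<forall>\<^sub>F N in sequentially. norm (orbit_correlation U g a b N - spectral_correlation U g a b F) \<le> \<delta>))"
    if \<delta>: "\<delta> > 0" for \<delta>
  proof -
    define \<epsilon> where "\<epsilon> = \<delta> / (7 * G)"
    have \<epsilon>: "\<epsilon> > 0" "7 * \<epsilon> * G = \<delta>"
      using \<delta> G(2) by (auto simp: \<epsilon>_def)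
    \<comment> \<open>Large components may sit at eigenvalues outside \<open>sigma_pp_a U\<close>.
      Passing to \<open>F \<union> B0\<close> makes the remainder small without changing the
      spectral sum.\<close>
    define B0 where "B0 = {z \<in> sphere 0 1. norm (eigenproj U z a) > \<epsilon>}"
    have B0: "finite B0" "B0 \<subseteq> sphere 0 1"
      using finite_large_eigenproj[OF U \<epsilon>(1)] by (auto simp: B0_def)
    have "\<forall>\<^sub>F N in sequentially. norm (orbit_correlation U g a b N - spectral_correlation U g a b F) \<le> \<delta>"
      if F: "finite F" "B0 \<inter> sigma_pp_a U \<subseteq> F" "F \<subseteq> sigma_pp_a U" for F
    proof -
      have sub: "F \<union> B0 \<subseteq> sphere 0 1"
        using F B0 by (auto simp: sigma_pp_a_def sigma_pp_def)
      have "(F \<union> B0) \<inter> sigma_pp_a U = F"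
        using F by auto
      then have "spectral_correlation U g a b (F \<union> B0) = spectral_correlation U g a b F"
        using spectral_correlation_restrict[of "F \<union> B0" a b] sub F B0 by simp
      moreover have "norm (eigenproj U z a) \<le> \<epsilon>" if "cmod z = 1" "z \<notin> F \<union> B0" for z
        using that by (auto simp: B0_def)
      ultimately show ?thesis
        using orbit_correlation_near_spectral[OF \<epsilon>(1) _ sub _ G, of a] F B0 \<epsilon>(2) by simp
    qed
    then show ?thesis
      using B0 by (intro exI[of _ "B0 \<inter> sigma_pp_a U"]) auto
  qed
  have "Cauchy (orbit_correlation U g a b)"
  proof (rule metric_CauchyI)
    fix e :: real assume "e > 0"
    then have "e / 3 > 0"
      by simp
    from near[OF this] obtain F0 where F0: "finite F0" "F0 \<subseteq> sigma_pp_a U"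
      "\<forall>F. finite F \<and> F0 \<subseteq> F \<and> F \<subseteq> sigma_pp_a U \<longrightarrow>
        (\<forall>\<^sub>F N in sequentially. norm (orbit_correlation U g a b N - spectral_correlation U g a b F) \<le> e / 3)"
      by blast
    then obtain M where "\<And>N. N \<ge> M \<Longrightarrow>
        dist (orbit_correlation U g a b N) (spectral_correlation U g a b F0) \<le> e / 3"
      unfolding eventually_sequentially dist_norm by blast
    note M = this
    have "dist (orbit_correlation U g a b m) (orbit_correlation U g a b n) < e" if "m \<ge> M" "n \<ge> M" for m n
      using M[OF that(1)] M[OF that(2)] \<open>e > 0\<close> dist_triangle2[of "orbit_correlation U g a b m"
          "orbit_correlation U g a b n" "spectral_correlation U g a b F0"] by linarith
    then show "\<exists>M. \<forall>m\<ge>M. \<forall>n\<ge>M. dist (orbit_correlation U g a b m) (orbit_correlation U g a b n) < e"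
      by blast
  qed
  then obtain l where l: "orbit_correlation U g a b \<longlonglongrightarrow> l"
    using Cauchy_convergent convergent_def by blast
  have "(spectral_correlation U g a b \<longlongrightarrow> l) (finite_subsets_at_top (sigma_pp_a U))"
  proof (rule tendstoI)
    fix e :: real assume e: "e > 0"
    then have "e / 2 > 0"
      by simp
    from near[OF this] obtain F0 where F0: "finite F0" "F0 \<subseteq> sigma_pp_a U"
      "\<And>F. finite F \<and> F0 \<subseteq> F \<and> F \<subseteq> sigma_pp_a U \<Longrightarrow>
        (\<forall>\<^sub>F N in sequentially. norm (orbit_correlation U g a b N - spectral_correlation U g a b F) \<le> e / 2)"
      by blast
    have "dist (spectral_correlation U g a b F) l < e" if "finite F \<and> F0 \<subseteq> F \<and> F \<subseteq> sigma_pp_a U" for F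
    proof -
      have "norm (l - spectral_correlation U g a b F) \<le> e / 2"
        by (rule tendsto_upperbound[OF tendsto_norm[OF tendsto_diff[OF l tendsto_const]] F0(3)[OF that]])
          simp
      then show ?thesis
        using e by (simp add: dist_norm norm_minus_commute)
    qed
    then show "\<forall>\<^sub>F F in finite_subsets_at_top (sigma_pp_a U). dist (spectral_correlation U g a b F) l < e"
      unfolding eventually_finite_subsets_at_top using F0 by blast
  qed
  with l that show thesis
    by blast
qed

end

section \<open>Approximation of compact operators\<close>

definition rank_one :: "('a::complex_inner \<Rightarrow> 'a) \<Rightarrow> bool" where
  "rank_one T \<longleftrightarrow> (\<exists>f e. bounded_functional f \<and> T = (\<lambda>x. f x *\<^sub>C e))"

text \<open>Built by adding one rank one operator at a time, which is the shape in which additivity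
  in a slot is exploited.\<close>

inductive finite_rank :: "('a::complex_inner \<Rightarrow> 'a) \<Rightarrow> bool" where
  finite_rank_zero: "finite_rank (\<lambda>x. 0)"
| finite_rank_add_rank_one: "finite_rank T \<Longrightarrow> rank_one R \<Longrightarrow> finite_rank (\<lambda>x. T x + R x)"

text \<open>The working class for the slot-by-slot reduction: it contains the compact and the rank
  one operators and is stable under subtracting a finite rank operator.\<close>

definition approximable :: "('a::complex_inner \<Rightarrow> 'a) \<Rightarrow> bool" where
  "approximable T \<longleftrightarrow> bounded_operator T \<and>
     (\<forall>\<epsilon>>0. \<exists>R. finite_rank R \<and> (\<forall>x. norm (T x - R x) \<le> \<epsilon> * norm x))"

lemma rank_one_bounded:
  assumes "rank_one T"
  shows "bounded_operator T"
proof -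
  obtain f e B where f: "bounded_functional f" "\<And>x. cmod (f x) \<le> B * norm x" "T = (\<lambda>x. f x *\<^sub>C e)"
    using assms unfolding rank_one_def bounded_functional_def by blast
  show ?thesis
  proof (rule bounded_operatorI)
    show "norm (T x) \<le> (norm e * B) * norm x" for x
      using mult_left_mono[OF f(2)[of x], of "norm e"] by (simp add: f(3) norm_scaleC mult_ac)
  qed (use f(1) in \<open>simp_all add: f(3) bounded_functional_def scaleC_add_left scaleC_scaleC\<close>)
qed

lemma rank_one_uminus:
  assumes "rank_one T"
  shows "rank_one (\<lambda>x. - T x)"
proof -
  obtain f e where "bounded_functional f" "T = (\<lambda>x. f x *\<^sub>C e)"
    using assms unfolding rank_one_def by blast
  then show ?thesis
    unfolding rank_one_def by (intro exI[of _ f] exI[of _ "- e"]) (simp add: scaleC_minus_right)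
qed

lemma finite_rank_bounded: "finite_rank T \<Longrightarrow> bounded_operator T"
proof (induction rule: finite_rank.induct)
  case finite_rank_zero
  show ?case
    by (rule bounded_operatorI[where B = 0]) auto
qed (simp add: bounded_operator_add rank_one_bounded)

lemma finite_rank_add:
  assumes "finite_rank S" "finite_rank T"
  shows "finite_rank (\<lambda>x. S x + T x)"
  using assms(2)
proof (induction rule: finite_rank.induct)
  case (finite_rank_add_rank_one T R)
  show ?case
    using finite_rank.finite_rank_add_rank_one[OF finite_rank_add_rank_one(3,2)]
    by (simp add: add.assoc)
qed (use assms(1) in simp)

lemma finite_rank_uminus: "finite_rank T \<Longrightarrow> finite_rank (\<lambda>x. - T x)"
proof (induction rule: finite_rank.induct)
  case (finite_rank_add_rank_one T R)
  show ?case
    using finite_rank.finite_rank_add_rank_one[OF finite_rank_add_rank_one(3)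
        rank_one_uminus[OF finite_rank_add_rank_one(2)]]
    by simp
qed (simp add: finite_rank_zero)

lemma finite_rank_sum:
  assumes "finite I" "\<And>i. i \<in> I \<Longrightarrow> rank_one (R i)"
  shows "finite_rank (\<lambda>x. \<Sum>i\<in>I. R i x)"
  using assms
proof (induction I rule: finite_induct)
  case (insert i I)
  then show ?case
    using finite_rank_add_rank_one[of "\<lambda>x. \<Sum>i\<in>I. R i x" "R i"] by (simp add: add.commute)
qed (simp add: finite_rank_zero)

lemma finite_rank_approximable: "finite_rank T \<Longrightarrow> approximable T"
  unfolding approximable_def by (auto simp: finite_rank_bounded intro!: exI[of _ T])

lemma rank_one_approximable: "rank_one T \<Longrightarrow> approximable T"
  using finite_rank_add_rank_one[OF finite_rank_zero, of T] by (simp add: finite_rank_approximable)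

lemma approximable_diff_finite_rank:
  assumes T: "approximable T" and R: "finite_rank R"
  shows "approximable (\<lambda>x. T x - R x)"
  unfolding approximable_def
proof (intro conjI allI impI)
  show "bounded_operator (\<lambda>x. T x - R x)"
    using assms by (intro bounded_operator_diff) (auto simp: approximable_def finite_rank_bounded)
next
  fix \<epsilon> :: real assume "\<epsilon> > 0"
  then obtain Q where Q: "finite_rank Q" "\<forall>x. norm (T x - Q x) \<le> \<epsilon> * norm x"
    using T unfolding approximable_def by blast
  show "\<exists>Q. finite_rank Q \<and> (\<forall>x. norm (T x - R x - Q x) \<le> \<epsilon> * norm x)"
    using finite_rank_add[OF Q(1) finite_rank_uminus[OF R]] Q(2)
    by (intro exI[of _ "\<lambda>x. Q x + - R x"]) (simp add: algebra_simps)
qed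

section \<open>Projections onto finite-dimensional subspaces\<close>

definition orthonormal :: "'a::complex_inner set \<Rightarrow> bool" where
  "orthonormal B \<longleftrightarrow> finite B \<and> (\<forall>e\<in>B. \<forall>e'\<in>B. cinner e e' = (if e = e' then 1 else 0))"

definition span_proj :: "'a::complex_inner set \<Rightarrow> 'a \<Rightarrow> 'a" where
  "span_proj B x = (\<Sum>e\<in>B. cinner e x *\<^sub>C e)"

lemma span_proj_orthogonal:
  assumes "orthonormal B" "e \<in> B"
  shows "cinner e (x - span_proj B x) = 0"
proof -
  have "cinner e (span_proj B x) = (\<Sum>e'\<in>B. if e' = e then cinner e' x else 0)"
    unfolding span_proj_def cinner_sum_right using assms
    by (intro sum.cong) (auto simp: orthonormal_def cinner_scaleC_right)
  then show ?thesis
    using assms by (simp add: orthonormal_def cinner_diff_right)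
qed

lemma norm_diff_span_proj_le:
  assumes "orthonormal B"
  shows "norm (x - span_proj B x) \<le> norm x"
proof -
  let ?p = "span_proj B x"
  have "cinner ?p (x - ?p) = (\<Sum>e\<in>B. cnj (cinner e x) * cinner e (x - ?p))"
    by (subst (1) span_proj_def) (simp add: cinner_sum_left cinner_scaleC_left)
  also have "\<dots> = 0"
    using span_proj_orthogonal[OF assms] by simp
  finally have "(norm x)\<^sup>2 = (norm ?p)\<^sup>2 + (norm (x - ?p))\<^sup>2"
    using norm_add_sq[of ?p "x - ?p"] by simp
  then have "(norm (x - ?p))\<^sup>2 \<le> (norm x)\<^sup>2"
    by simp
  then show ?thesis
    by (rule power2_le_imp_le) simp
qed

lemma span_proj_diff: "span_proj B (x - y) = span_proj B x - span_proj B y"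
  by (simp add: span_proj_def cinner_diff_right bounded_bilinear.diff_left[OF bounded_bilinear_scaleC]
      sum_subtractf)

text \<open>Gram-Schmidt, one vector at a time: the component \<open>r\<close> of \<open>s\<close>
  orthogonal to the earlier span is normalized and added, unless it vanishes.\<close>

lemma orthonormal_exists:
  fixes S :: "'a::complex_inner set"
  assumes "finite S"
  shows "\<exists>B. orthonormal B \<and> (\<forall>s\<in>S. span_proj B s = s)"
  using assms
proof (induction S rule: finite_induct)
  case empty
  show ?case
    by (rule exI[of _ "{}"]) (simp add: orthonormal_def)
next
  case (insert s S)
  then obtain B where B: "orthonormal B" "\<forall>s\<in>S. span_proj B s = s"
    by blast
  define r where "r = s - span_proj B s"
  show ?case
  proof (cases "r = 0")
    case True
    then show ?thesis
      using B by (intro exI[of _ B]) (simp add: r_def)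
  next
    case False
    define e where "e = complex_of_real (1 / norm r) *\<^sub>C r"
    have Br: "cinner b r = 0" if "b \<in> B" for b
      unfolding r_def using span_proj_orthogonal[OF B(1) that] .
    then have Be: "cinner b e = 0" "cinner e b = 0" if "b \<in> B" for b
      using that cinner_commute[of e b] by (simp_all add: e_def cinner_scaleC_right)
    have rr: "cinner r r = complex_of_real (norm r) * complex_of_real (norm r)"
      by (simp add: cinner_self power2_eq_square)
    have ee: "cinner e e = 1"
      using False by (simp add: e_def cinner_scaleC_right cinner_scaleC_left rr)
    have eB: "e \<notin> B"
      using Be ee by (metis zero_neq_one)
    have ins: "span_proj (insert e B) x = cinner e x *\<^sub>C e + span_proj B x" for x
      using B(1) eB by (simp add: span_proj_def orthonormal_def)
    have e_span: "cinner e (span_proj B x) = 0" for x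
      by (simp add: span_proj_def cinner_sum_right cinner_scaleC_right Be)
    have "cinner e s = cinner e r"
      by (simp add: r_def cinner_diff_right e_span)
    then have "cinner e s *\<^sub>C e = r"
      using False by (simp add: e_def cinner_scaleC_left rr scaleC_scaleC scaleC_one)
    then have "span_proj (insert e B) s = s"
      by (simp add: ins r_def)
    moreover have "span_proj (insert e B) t = t" if "t \<in> S" for t
      using B(2) that e_span[of t] by (simp add: ins)
    moreover have "orthonormal (insert e B)"
      using B(1) Be ee eB by (auto simp: orthonormal_def)
    ultimately show ?thesis
      by (intro exI[of _ "insert e B"]) simp
  qed
qed

text \<open>Take a finite \<open>\<epsilon>\<close>-net \<open>S\<close> of the image of the unit
  ball and project onto the span of \<open>S\<close>. The complementary projection kills each net
  point and is a contraction, so its value at \<open>T u\<close> is no larger than the distance from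
  \<open>T u\<close> to the net.\<close>

lemma compact_operator_approximable:
  fixes T :: "'a::complex_inner \<Rightarrow> 'a"
  assumes "compact_operator T"
  shows "approximable T"
  unfolding approximable_def
proof (intro conjI allI impI)
  show T: "bounded_operator T"
    using assms by (simp add: compact_operator_def)
  note lin = bounded_operator_linear[OF T]
  fix \<epsilon> :: real assume \<epsilon>: "\<epsilon> > 0"
  obtain S where S: "finite S" "closure (T ` cball 0 1) \<subseteq> (\<Union>s\<in>S. ball s \<epsilon>)"
    using seq_compact_imp_totally_bounded[OF compact_imp_seq_compact, of "closure (T ` cball 0 1)"]
      assms \<epsilon> unfolding compact_operator_def by meson
  obtain B where B: "orthonormal B" "\<forall>s\<in>S. span_proj B s = s"
    using orthonormal_exists[OF S(1)] by blast
  have "finite_rank (\<lambda>x. span_proj B (T x))"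
    unfolding span_proj_def
  proof (rule finite_rank_sum)
    show "rank_one (\<lambda>x. cinner e (T x) *\<^sub>C e)" for e
      unfolding rank_one_def using bounded_functional_cinner[OF T] by blast
  qed (use B(1) in \<open>simp add: orthonormal_def\<close>)
  moreover have "norm (T x - span_proj B (T x)) \<le> \<epsilon> * norm x" for x
  proof (cases "x = 0")
    case True
    then show ?thesis
      by (simp add: linear_0[OF lin] span_proj_def)
  next
    case False
    define u where "u = (1 / norm x) *\<^sub>R x"
    have "T u \<in> closure (T ` cball 0 1)"
      using closure_subset[of "T ` cball 0 1"] by (auto simp: u_def)
    then obtain s where s: "s \<in> S" "norm (T u - s) < \<epsilon>"
      using S(2) by (auto simp: dist_norm norm_minus_commute)
    have "T u - span_proj B (T u) = (T u - s) - span_proj B (T u - s)"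
      using B(2) s(1) by (simp add: span_proj_diff)
    also have "norm \<dots> \<le> norm (T u - s)"
      by (rule norm_diff_span_proj_le[OF B(1)])
    finally have u_le: "norm (T u - span_proj B (T u)) \<le> \<epsilon>"
      using s(2) by simp
    have "x = norm x *\<^sub>R u"
      using False by (simp add: u_def)
    then have "T x = complex_of_real (norm x) *\<^sub>C T u"
      by (metis linear_scale[OF lin] scaleR_scaleC)
    then have "T x - span_proj B (T x) = complex_of_real (norm x) *\<^sub>C (T u - span_proj B (T u))"
      by (simp add: span_proj_def cinner_scaleC_right scaleC_diff_right scaleC_sum_right scaleC_scaleC)
    then show ?thesis
      using u_le by (simp add: norm_scaleC mult_left_mono mult.commute[of \<epsilon>])
  qed
  ultimately show "\<exists>R. finite_rank R \<and> (\<forall>x. norm (T x - R x) \<le> \<epsilon> * norm x)"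
    by blast
qed

text \<open>In one slot at a time, a finite rank approximation splits by additivity into rank one
  terms, and the remainder is controlled by the product bound with a small factor in that slot.
  Index type and filter are left open: the lemma serves for a constant sequence, where it proves an
  identity, and for pairs of indices. \<open>P\<close> singles out the indices where additivity and
  the bound are available, such as finite subsets of the circle.\<close>

lemma multilinear_tendsto_zero:
  fixes \<phi> :: "'i \<Rightarrow> (nat \<Rightarrow> 'a::complex_inner \<Rightarrow> 'a) \<Rightarrow> 'b::real_normed_vector"
  assumes ev: "eventually P Fl"
    and add: "\<And>\<iota> A i S T. P \<iota> \<Longrightarrow> i \<in> {1..M} \<Longrightarrow> \<forall>j\<in>{1..M}. approximable (A j) \<Longrightarrow>
        approximable S \<Longrightarrow> approximable T \<Longrightarrow>
        \<phi> \<iota> (A(i := \<lambda>x. S x + T x)) = \<phi> \<iota> (A(i := S)) + \<phi> \<iota> (A(i := T))"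
    and bound: "\<And>\<iota> A \<beta>. P \<iota> \<Longrightarrow> \<forall>j\<in>{1..M}. approximable (A j) \<Longrightarrow>
        \<forall>j\<in>{1..M}. \<beta> j \<ge> 0 \<and> (\<forall>x. norm (A j x) \<le> \<beta> j * norm x) \<Longrightarrow>
        norm (\<phi> \<iota> A) \<le> K * (\<Prod>j\<in>{1..M}. \<beta> j)"
    and rank_one: "\<And>A. \<forall>j\<in>{1..M}. rank_one (A j) \<Longrightarrow> ((\<lambda>\<iota>. \<phi> \<iota> A) \<longlongrightarrow> 0) Fl"
    and A: "\<forall>j\<in>{1..M}. approximable (A j)"
  shows "((\<lambda>\<iota>. \<phi> \<iota> A) \<longlongrightarrow> 0) Fl"
proof -
  \<comment> \<open>Strengthened for induction on \<open>m\<close>: the slots beyond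
    \<open>m\<close> already hold rank one operators. The claim is the case
    \<open>m = M\<close>.\<close>
  have "((\<lambda>\<iota>. \<phi> \<iota> A) \<longlongrightarrow> 0) Fl"
    if "\<forall>j\<in>{1..M}. approximable (A j)" "\<forall>j\<in>{1..M}. m < j \<longrightarrow> rank_one (A j)" for m A
    using that
  proof (induction m arbitrary: A)
    case 0
    then show ?case
      by (intro rank_one) auto
  next
    case (Suc m)
    define i where "i = Suc m"
    show ?case
    proof (cases "i \<in> {1..M}")
      case False
      then show ?thesis
        using Suc.prems by (intro Suc.IH) (auto simp: i_def)
    next
      case i: True
      have IH: "((\<lambda>\<iota>. \<phi> \<iota> (A(i := R))) \<longlongrightarrow> 0) Fl" if "rank_one R" for R
        using Suc.prems that by (intro Suc.IH) (auto simp: i_def rank_one_approximable)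
      have finite_rank: "((\<lambda>\<iota>. \<phi> \<iota> (A(i := R))) \<longlongrightarrow> 0) Fl" if "finite_rank R" for R
        using that
      proof (induction rule: finite_rank.induct)
        case finite_rank_zero
        have z: "approximable (\<lambda>x::'a. 0::'a)"
          by (rule finite_rank_approximable[OF finite_rank.finite_rank_zero])
        \<comment> \<open>Additivity for zero plus zero says that the value equals its own
          double.\<close>
        have "\<phi> \<iota> (A(i := \<lambda>x. 0)) = 0" if "P \<iota>" for \<iota>
          using add[OF that i Suc.prems(1) z z] by simp
        then show ?case
          by (intro tendsto_eventually eventually_mono[OF ev])
      next
        case (finite_rank_add_rank_one T R)
        have "((\<lambda>\<iota>. \<phi> \<iota> (A(i := T)) + \<phi> \<iota> (A(i := R))) \<longlongrightarrow> 0 + 0) Fl"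
          by (intro tendsto_add finite_rank_add_rank_one IH)
        moreover have "\<forall>\<^sub>F \<iota> in Fl. \<phi> \<iota> (A(i := T)) + \<phi> \<iota> (A(i := R)) = \<phi> \<iota> (A(i := \<lambda>x. T x + R x))"
          using ev
        proof eventually_elim
          case (elim \<iota>)
          show ?case
            using finite_rank_add_rank_one
            by (intro add[symmetric] elim i Suc.prems(1) finite_rank_approximable rank_one_approximable)
        qed
        ultimately show ?case
          by (simp only: add_0_left Lim_transform_eventually)
      qed
      have "\<forall>j\<in>{1..M}. \<exists>B. B \<ge> 0 \<and> (\<forall>x. norm (A j x) \<le> B * norm x)"
        using Suc.prems(1) bounded_operator_bound unfolding approximable_def by metis
      then obtain \<beta> where \<beta>: "\<forall>j\<in>{1..M}. \<beta> j \<ge> 0 \<and> (\<forall>x. norm (A j x) \<le> \<beta> j * norm x)"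
        by metis
      \<comment> \<open>The absolute value covers either sign of \<open>K\<close>, and the summand
        \<open>1\<close> keeps \<open>C\<close> positive for the division in
        \<open>\<epsilon>\<close>.\<close>
      define C where "C = \<bar>K * (\<Prod>j\<in>{1..M} - {i}. \<beta> j)\<bar> + 1"
      have C: "C > 0"
        by (simp add: C_def add_nonneg_pos)
      show ?thesis
      proof (rule tendstoI)
        fix e :: real assume e: "e > 0"
        define \<epsilon> where "\<epsilon> = e / (2 * C)"
        have \<epsilon>: "\<epsilon> > 0" "\<epsilon> * C = e / 2"
          using e C by (simp_all add: \<epsilon>_def)
        obtain R where R: "finite_rank R" "\<And>x. norm (A i x - R x) \<le> \<epsilon> * norm x"
          using Suc.prems(1) i \<epsilon>(1) unfolding approximable_def by meson
        define D where "D = (\<lambda>x. A i x - R x)"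
        have D: "approximable D"
          unfolding D_def using Suc.prems(1) i R(1) by (intro approximable_diff_finite_rank) auto
        have split: "A = A(i := \<lambda>x. R x + D x)"
          by (simp add: D_def)
        from tendstoD[OF finite_rank[OF R(1)], of "e / 2"] e
        have "\<forall>\<^sub>F \<iota> in Fl. dist (\<phi> \<iota> (A(i := R))) 0 < e / 2"
          by simp
        with ev show "\<forall>\<^sub>F \<iota> in Fl. dist (\<phi> \<iota> A) 0 < e"
        proof eventually_elim
          case (elim \<iota>)
          have "norm (\<phi> \<iota> (A(i := D))) \<le> K * (\<Prod>j\<in>{1..M}. (\<beta>(i := \<epsilon>)) j)"
            using Suc.prems(1) D \<beta> R(2) \<epsilon>(1) by (intro bound elim) (auto simp: D_def)
          also have "(\<Prod>j\<in>{1..M}. (\<beta>(i := \<epsilon>)) j) = \<epsilon> * (\<Prod>j\<in>{1..M} - {i}. \<beta> j)"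
            using i by (subst prod.remove[of _ i]) (auto intro!: prod.cong)
          also have "K * \<dots> \<le> \<epsilon> * C"
            using \<epsilon>(1) by (simp add: C_def mult.left_commute[of K] mult_left_mono)
          finally have "norm (\<phi> \<iota> (A(i := D))) \<le> e / 2"
            unfolding \<epsilon>(2) .
          moreover have "\<phi> \<iota> A = \<phi> \<iota> (A(i := R)) + \<phi> \<iota> (A(i := D))"
            using add[OF elim(1) i Suc.prems(1) finite_rank_approximable[OF R(1)] D] split by simp
          ultimately show ?case
            using elim(2) norm_triangle_ineq[of "\<phi> \<iota> (A(i := R))" "\<phi> \<iota> (A(i := D))"]
            by simp
        qed
      qed
    qed
  qed
  from this[of A M] show ?thesis
    using A by auto
qed

section \<open>Alternating products\<close>

lemma alt_prod_cong:
  assumes "\<And>p. p \<in> {1..Suc m} \<Longrightarrow> X p = X' p" "\<And>j. j \<in> {1..m} \<Longrightarrow> A j = A' j"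
  shows "alt_prod X A m = alt_prod X' A' m"
  using assms by (induction m) auto

lemma bounded_operator_alt_prod:
  assumes "\<And>p. p \<in> {1..Suc m} \<Longrightarrow> bounded_operator (X p)" "\<And>j. j \<in> {1..m} \<Longrightarrow> bounded_operator (A j)"
  shows "bounded_operator (alt_prod X A m)"
  using assms by (induction m) (auto intro!: bounded_operator_compose simp del: o_apply)

lemma norm_alt_prod_le:
  assumes "\<And>p x. p \<in> {1..Suc m} \<Longrightarrow> norm (X p x) \<le> norm x"
    "\<And>j. j \<in> {1..m} \<Longrightarrow> \<beta> j \<ge> 0 \<and> (\<forall>x. norm (A j x) \<le> \<beta> j * norm x)"
  shows "norm (alt_prod X A m x) \<le> (\<Prod>j\<in>{1..m}. \<beta> j) * norm x"
  using assms
proof (induction m arbitrary: x)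
  case (Suc m)
  let ?u = "X (Suc (Suc m)) x" and ?P = "\<Prod>j\<in>{1..m}. \<beta> j"
  have P: "?P \<ge> 0"
    using Suc.prems(2) by (intro prod_nonneg) auto
  have "norm (alt_prod X A (Suc m) x) \<le> ?P * norm (A (Suc m) ?u)"
    using Suc.IH[of "A (Suc m) ?u"] Suc.prems by simp
  also have "\<dots> \<le> ?P * (\<beta> (Suc m) * norm ?u)"
    using Suc.prems(2)[of "Suc m"] P by (intro mult_left_mono) auto
  also have "\<dots> \<le> ?P * (\<beta> (Suc m) * norm x)"
    using Suc.prems(1)[of "Suc (Suc m)" x] Suc.prems(2)[of "Suc m"] P
    by (intro mult_left_mono) auto
  finally show ?case
    by (simp add: mult_ac)
qed simp

lemma alt_prod_add:
  assumes "\<And>p. p \<in> {1..Suc m} \<Longrightarrow> bounded_operator (X p)"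
    "\<And>j. j \<in> {1..m} \<Longrightarrow> bounded_operator (A j)" "i \<in> {1..m}"
  shows "alt_prod X (A(i := \<lambda>x. S x + T x)) m x = alt_prod X (A(i := S)) m x + alt_prod X (A(i := T)) m x"
  using assms
proof (induction m arbitrary: x)
  case (Suc m)
  show ?case
  proof (cases "i = Suc m")
    case True
    have "alt_prod X (A(Suc m := R)) m = alt_prod X A m" for R
      by (rule alt_prod_cong) auto
    moreover have "linear (alt_prod X A m)"
      using Suc.prems by (intro bounded_operator_linear bounded_operator_alt_prod) auto
    ultimately show ?thesis
      by (simp add: True linear_add del: fun_upd_apply) (simp add: linear_add)
  next
    case False
    then show ?thesis
      using Suc by simp
  qed
qed simp

text \<open>Each rank one operator cuts the product: everything to its right becomes a scalar, which
  linearity moves to the front. The argument is called \<open>e (Suc m)\<close> so that every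
  position \<open>p\<close> acts on a vector \<open>e p\<close>.\<close>

lemma alt_prod_rank_one:
  assumes "\<And>p. p \<in> {1..Suc m} \<Longrightarrow> bounded_operator (X p)"
    "\<And>j. j \<in> {1..m} \<Longrightarrow> bounded_functional (f j) \<and> A j = (\<lambda>x. f j x *\<^sub>C e j)"
  shows "alt_prod X A m (e (Suc m)) = (\<Prod>j\<in>{1..m}. f j (X (Suc j) (e (Suc j)))) *\<^sub>C X 1 (e 1)"
  using assms
proof (induction m)
  case (Suc m)
  have "rank_one (A j)" if "j \<in> {1..m}" for j
    using Suc.prems(2)[of j] that unfolding rank_one_def by auto
  then have "bounded_operator (alt_prod X A m)"
    using Suc.prems(1) by (intro bounded_operator_alt_prod) (auto simp: rank_one_bounded)
  moreover have "A (Suc m) = (\<lambda>x. f (Suc m) x *\<^sub>C e (Suc m))"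
    using Suc.prems(2)[of "Suc m"] by simp
  ultimately show ?case
    using Suc by (simp add: bounded_operator_scaleC scaleC_scaleC mult.commute)
qed (simp add: scaleC_one)

section \<open>Sums over pair partitions\<close>

definition pair_fst :: "nat \<Rightarrow> (nat \<Rightarrow> nat) \<Rightarrow> nat \<Rightarrow> nat" where
  "pair_fst k \<alpha> j = Min {p \<in> {1..2*k}. \<alpha> p = j}"

definition pair_snd :: "nat \<Rightarrow> (nat \<Rightarrow> nat) \<Rightarrow> nat \<Rightarrow> nat" where
  "pair_snd k \<alpha> j = Max {p \<in> {1..2*k}. \<alpha> p = j}"

text \<open>A common form for three sums: powers of \<open>U\<close> at both positions,
  eigenprojections at \<open>z\<close> and \<open>cnj z\<close>, and the phase combinations used to
  bound the spectral sums.\<close>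

definition pair_op ::
  "nat \<Rightarrow> (nat \<Rightarrow> nat) \<Rightarrow> ('i \<Rightarrow> 'a \<Rightarrow> 'a) \<Rightarrow> ('i \<Rightarrow> 'a \<Rightarrow> 'a) \<Rightarrow> (nat \<Rightarrow> 'i) \<Rightarrow> nat \<Rightarrow> 'a \<Rightarrow> 'a" where
  "pair_op k \<alpha> Y Z i p = (if p = pair_fst k \<alpha> (\<alpha> p) then Y (i (\<alpha> p)) else Z (i (\<alpha> p)))"

definition pair_sum ::
  "nat \<Rightarrow> (nat \<Rightarrow> nat) \<Rightarrow> 'i set \<Rightarrow> ('i \<Rightarrow> 'a \<Rightarrow> 'a) \<Rightarrow> ('i \<Rightarrow> 'a \<Rightarrow> 'a) \<Rightarrow>
    (nat \<Rightarrow> 'a \<Rightarrow> 'a) \<Rightarrow> 'a::complex_inner \<Rightarrow> 'a" where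
  "pair_sum k \<alpha> I Y Z A x = (\<Sum>i \<in> {1..k} \<rightarrow>\<^sub>E I. alt_prod (pair_op k \<alpha> Y Z i) A (2*k - 1) x)"

definition pair_correlation ::
  "'i set \<Rightarrow> ('i \<Rightarrow> 'a \<Rightarrow> 'a) \<Rightarrow> ('i \<Rightarrow> 'a \<Rightarrow> 'a) \<Rightarrow> ('a \<Rightarrow> complex) \<Rightarrow> 'a \<Rightarrow> 'a \<Rightarrow> 'a::complex_inner" where
  "pair_correlation I Y Z g a b = (\<Sum>t\<in>I. g (Z t b) *\<^sub>C Y t a)"

lemma S_partial_eq_pair_sum:
  "S_partial U k \<alpha> A F x = pair_sum k \<alpha> F (\<lambda>z. eigenproj U z) (\<lambda>z. eigenproj U (cnj z)) A x"
proof -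
  have "(\<lambda>p. eigenproj U (z_sharp k \<alpha> z p)) =
      pair_op k \<alpha> (\<lambda>z. eigenproj U z) (\<lambda>z. eigenproj U (cnj z)) z" for z
    by (rule ext) (simp add: pair_op_def pair_fst_def z_sharp_def)
  then show ?thesis
    by (simp add: S_partial_def pair_sum_def)
qed

lemma ergodic_average_eq_pair_sum:
  "ergodic_average U k \<alpha> A N x =
    (1 / real N) ^ k *\<^sub>R pair_sum k \<alpha> {..<N} (\<lambda>n. U ^^ n) (\<lambda>n. U ^^ n) A x"
proof -
  have "(\<lambda>p. U ^^ n (\<alpha> p)) = pair_op k \<alpha> (\<lambda>n. U ^^ n) (\<lambda>n. U ^^ n) n" for n
    by (rule ext) (simp add: pair_op_def)
  then show ?thesis
    by (simp add: ergodic_average_def pair_sum_def power_one_over atLeast0LessThan)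
qed

context
  fixes k :: nat and \<alpha> :: "nat \<Rightarrow> nat"
  assumes k: "k \<ge> 1" and \<alpha>: "pair_partition k \<alpha>"
begin

lemma pair_partition_in: "p \<in> {1..2*k} \<Longrightarrow> \<alpha> p \<in> {1..k}"
  using \<alpha> by (auto simp: pair_partition_def)

lemma
  assumes j: "j \<in> {1..k}"
  shows pair_block: "{p \<in> {1..2*k}. \<alpha> p = j} = {pair_fst k \<alpha> j, pair_snd k \<alpha> j}"
    and pair_fst_less_snd: "pair_fst k \<alpha> j < pair_snd k \<alpha> j"
proof -
  have "card {p \<in> {1..2*k}. \<alpha> p = j} = 2"
    using \<alpha> j by (simp add: pair_partition_def)
  then obtain p q where pq: "{p \<in> {1..2*k}. \<alpha> p = j} = {p, q}" "p < q"
    by (metis (no_types, lifting) card_2_iff insert_commute linorder_neqE_nat)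
  then have "pair_fst k \<alpha> j = p" "pair_snd k \<alpha> j = q"
    by (simp_all add: pair_fst_def pair_snd_def)
  with pq show "{p \<in> {1..2*k}. \<alpha> p = j} = {pair_fst k \<alpha> j, pair_snd k \<alpha> j}"
    "pair_fst k \<alpha> j < pair_snd k \<alpha> j"
    by simp_all
qed

lemma pair_positions:
  assumes "j \<in> {1..k}"
  shows "pair_fst k \<alpha> j \<in> {1..2*k}" "pair_snd k \<alpha> j \<in> {1..2*k}"
    "\<alpha> (pair_fst k \<alpha> j) = j" "\<alpha> (pair_snd k \<alpha> j) = j"
  using pair_block[OF assms] by blast+

text \<open>Position \<open>1\<close> is the only one without an operator to its left; its pair
  therefore yields a vector, while all other pairs yield scalars.\<close>

lemma pair_fst_first: "pair_fst k \<alpha> (\<alpha> 1) = 1"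
proof -
  have "pair_fst k \<alpha> (\<alpha> 1) \<le> 1"
    unfolding pair_fst_def using k by (intro Min_le) auto
  then show ?thesis
    using pair_positions(1)[OF pair_partition_in, of 1] k by simp
qed

text \<open>The shift by one reflects that the vector at position \<open>p\<close> enters the
  functional of \<open>A (p - 1)\<close>; a second position is never \<open>1\<close>.\<close>

lemma pair_snd_pred_in: "j \<in> {1..k} \<Longrightarrow> pair_snd k \<alpha> j - 1 \<in> {1..2*k - 1}"
  using pair_fst_less_snd[of j] pair_positions(1,2)[of j] by auto

lemma pair_fst_pred_in: "j \<in> {1..k} - {\<alpha> 1} \<Longrightarrow> pair_fst k \<alpha> j - 1 \<in> {1..2*k - 1}"
  using pair_positions(1,3)[of j] by (cases "pair_fst k \<alpha> j = 1") auto

lemma bounded_operator_pair_op: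
  assumes "\<And>t. t \<in> I \<Longrightarrow> bounded_operator (Y t) \<and> bounded_operator (Z t)"
    "i \<in> {1..k} \<rightarrow>\<^sub>E I" "p \<in> {1..2*k}"
  shows "bounded_operator (pair_op k \<alpha> Y Z i p)"
  using assms(1)[OF PiE_mem[OF assms(2) pair_partition_in[OF assms(3)]]] by (simp add: pair_op_def)

lemma pair_sum_add:
  assumes "\<And>t. t \<in> I \<Longrightarrow> bounded_operator (Y t) \<and> bounded_operator (Z t)"
    "\<And>j. j \<in> {1..2*k - 1} \<Longrightarrow> bounded_operator (A j)" "j \<in> {1..2*k - 1}"
  shows "pair_sum k \<alpha> I Y Z (A(j := \<lambda>x. S x + T x)) x =
    pair_sum k \<alpha> I Y Z (A(j := S)) x + pair_sum k \<alpha> I Y Z (A(j := T)) x"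
  unfolding pair_sum_def sum.distrib[symmetric]
  using assms k by (intro sum.cong refl alt_prod_add bounded_operator_pair_op) auto

lemma norm_pair_sum_le:
  fixes Y Z :: "'i \<Rightarrow> 'a::complex_inner \<Rightarrow> 'a"
  assumes "finite I" "\<And>t x. t \<in> I \<Longrightarrow> norm (Y t x) \<le> norm x \<and> norm (Z t x) \<le> norm x"
    "\<forall>j\<in>{1..2*k - 1}. \<beta> j \<ge> 0 \<and> (\<forall>x. norm (A j x) \<le> \<beta> j * norm x)"
  shows "norm (pair_sum k \<alpha> I Y Z A x) \<le> real (card I) ^ k * ((\<Prod>j\<in>{1..2*k - 1}. \<beta> j) * norm x)"
proof -
  have "norm (pair_sum k \<alpha> I Y Z A x) \<le> real (card ({1..k} \<rightarrow>\<^sub>E I)) * ((\<Prod>j\<in>{1..2*k - 1}. \<beta> j) * norm x)"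
    unfolding pair_sum_def
  proof (rule sum_norm_bound)
    fix i assume i: "i \<in> {1..k} \<rightarrow>\<^sub>E I"
    show "norm (alt_prod (pair_op k \<alpha> Y Z i) A (2*k - 1) x) \<le> (\<Prod>j\<in>{1..2*k - 1}. \<beta> j) * norm x"
    proof (rule norm_alt_prod_le)
      fix p and x :: 'a assume "p \<in> {1..Suc (2*k - 1)}"
      then have "i (\<alpha> p) \<in> I"
        using k i pair_partition_in[of p] by (intro PiE_mem[OF i]) auto
      then show "norm (pair_op k \<alpha> Y Z i p x) \<le> norm x"
        using assms(2) by (simp add: pair_op_def)
    qed (use assms(3) in blast)
  qed
  then show ?thesis
    using assms(1) by (simp add: card_PiE)
qed

lemma norm_pair_average_le:
  fixes Y Z :: "'i \<Rightarrow> 'a::complex_inner \<Rightarrow> 'a"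
  assumes "finite I" "\<And>t x. t \<in> I \<Longrightarrow> norm (Y t x) \<le> norm x \<and> norm (Z t x) \<le> norm x"
    "\<forall>j\<in>{1..2*k - 1}. \<beta> j \<ge> 0 \<and> (\<forall>x. norm (A j x) \<le> \<beta> j * norm x)"
  shows "norm ((1 / real (card I)) ^ k *\<^sub>R pair_sum k \<alpha> I Y Z A x) \<le> (\<Prod>j\<in>{1..2*k - 1}. \<beta> j) * norm x"
proof -
  have "(\<Prod>j\<in>{1..2*k - 1}. \<beta> j) * norm x \<ge> 0"
    using assms(3) by (intro mult_nonneg_nonneg prod_nonneg) auto
  \<comment> \<open>For an empty index set the factor \<open>(1 / 0) ^ k\<close> is
    \<open>0\<close>, as \<open>k \<ge> 1\<close>.\<close>
  then show ?thesis
    using norm_pair_sum_le[OF assms, where x = x] k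
    by (cases "card I = 0") (auto simp: power_one_over field_simps zero_power)
qed

text \<open>For rank one operators \<open>A j\<close> every summand is a product of matrix coefficients, one for each
  position, so that grouping the positions in pairs factorizes the sum.\<close>

lemma pair_sum_rank_one:
  fixes Y Z :: "'i \<Rightarrow> 'a::complex_inner \<Rightarrow> 'a" and c :: real
  assumes A: "\<And>j. j \<in> {1..2*k - 1} \<Longrightarrow> bounded_functional (f j) \<and> A j = (\<lambda>x. f j x *\<^sub>C e j)"
    and I: "finite I" "\<And>t. t \<in> I \<Longrightarrow> bounded_operator (Y t) \<and> bounded_operator (Z t)"
  defines "W \<equiv> \<lambda>j. c *\<^sub>R pair_correlation I Y Z (f (pair_snd k \<alpha> j - 1)) (e (pair_fst k \<alpha> j)) (e (pair_snd k \<alpha> j))"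
  shows "c ^ k *\<^sub>R pair_sum k \<alpha> I Y Z A (e (2*k)) =
    (\<Prod>j\<in>{1..k} - {\<alpha> 1}. f (pair_fst k \<alpha> j - 1) (W j)) *\<^sub>C W (\<alpha> 1)"
proof (rule cinner_ext)
  fix y
  \<comment> \<open>A test vector \<open>y\<close> supplies the missing functional at position
    \<open>1\<close>, so that all \<open>2*k\<close> positions contribute a scalar and can be
    regrouped freely.\<close>
  define h where "h p = (if p = 1 then cinner y else f (p - 1))" for p :: nat
  have h1: "h 1 = cinner y"
    by (simp add: h_def)
  have hf: "h p = f (p - 1)" if "p \<noteq> 1" for p
    using that by (simp add: h_def)
  have h: "bounded_functional (h p)" if "p \<in> {1..2*k}" for p
  proof (cases "p = 1")
    case True
    then show ?thesis
      using bounded_functional_cinner[OF bounded_operator_id, of y] by (simp only: True h1)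
  next
    case False
    then have "p - 1 \<in> {1..2*k - 1}"
      using that by auto
    with A False show ?thesis
      by (simp only: hf not_False_eq_True)
  qed
  let ?a = "\<lambda>j. e (pair_fst k \<alpha> j)" and ?b = "\<lambda>j. e (pair_snd k \<alpha> j)"
  let ?u = "\<lambda>j t. h (pair_fst k \<alpha> j) (Y t (?a j)) * h (pair_snd k \<alpha> j) (Z t (?b j))"
  have summand: "cinner y (alt_prod (pair_op k \<alpha> Y Z i) A (2*k - 1) (e (2*k))) = (\<Prod>j\<in>{1..k}. ?u j (i j))"
    if i: "i \<in> {1..k} \<rightarrow>\<^sub>E I" for i
  proof -
    let ?X = "pair_op k \<alpha> Y Z i"
    have "alt_prod ?X A (2*k - 1) (e (Suc (2*k - 1))) =
        (\<Prod>j\<in>{1..2*k - 1}. f j (?X (Suc j) (e (Suc j)))) *\<^sub>C ?X 1 (e 1)"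
      using k A i I by (intro alt_prod_rank_one bounded_operator_pair_op) auto
    then have "cinner y (alt_prod ?X A (2*k - 1) (e (2*k))) =
        (\<Prod>j\<in>{1..2*k - 1}. h (Suc j) (?X (Suc j) (e (Suc j)))) * h 1 (?X 1 (e 1))"
      using k by (simp add: cinner_scaleC_right h_def)
    also have "\<dots> = (\<Prod>p\<in>{1..2*k}. h p (?X p (e p)))"
    proof -
      obtain m where m: "2*k = Suc m"
        using k by (cases "2*k") auto
      have "(\<Prod>p\<in>{1..Suc m}. w p) = (\<Prod>j\<in>{1..m}. w (Suc j)) * w 1" for w :: "nat \<Rightarrow> complex"
        using prod.atLeast_Suc_atMost[of 1 "Suc m" w] prod.shift_bounds_cl_Suc_ivl[of w 1 m]
        by (simp only: One_nat_def Suc_le_mono mult.commute le0)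
      then show ?thesis
        by (simp only: m diff_Suc_1)
    qed
    also have "\<dots> = (\<Prod>j\<in>{1..k}. \<Prod>p\<in>{p \<in> {1..2*k}. \<alpha> p = j}. h p (?X p (e p)))"
      using pair_partition_in by (intro prod.group[symmetric]) auto
    also have "\<dots> = (\<Prod>j\<in>{1..k}. ?u j (i j))"
    proof (rule prod.cong[OF refl])
      fix j assume j: "j \<in> {1..k}"
      show "(\<Prod>p\<in>{p \<in> {1..2*k}. \<alpha> p = j}. h p (?X p (e p))) = ?u j (i j)"
        unfolding pair_block[OF j] using pair_fst_less_snd[OF j] pair_positions[OF j]
        by (simp add: pair_op_def)
    qed
    finally show ?thesis .
  qed
  have factor: "(\<Sum>t\<in>I. ?u j t) = h (pair_fst k \<alpha> j)
      (pair_correlation I Y Z (f (pair_snd k \<alpha> j - 1)) (?a j) (?b j))" if j: "j \<in> {1..k}" for j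
  proof -
    have "h (pair_snd k \<alpha> j) = f (pair_snd k \<alpha> j - 1)"
      using pair_fst_less_snd[OF j] pair_positions[OF j] by (intro hf) auto
    then show ?thesis
      using h[OF pair_positions(1)[OF j]]
      by (simp add: pair_correlation_def bounded_functional_sum bounded_functional_scaleC mult.commute)
  qed
  have j0: "\<alpha> 1 \<in> {1..k}"
    using pair_partition_in[of 1] k by simp
  have other: "pair_fst k \<alpha> j \<noteq> 1" if "j \<in> {1..k} - {\<alpha> 1}" for j
    using that pair_positions(3)[of j] by auto
  have "cinner y (c ^ k *\<^sub>R pair_sum k \<alpha> I Y Z A (e (2*k))) =
      of_real c ^ k * (\<Sum>i\<in>{1..k} \<rightarrow>\<^sub>E I. \<Prod>j\<in>{1..k}. ?u j (i j))"
  proof -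
    have "cinner y (pair_sum k \<alpha> I Y Z A (e (2*k))) = (\<Sum>i\<in>{1..k} \<rightarrow>\<^sub>E I. \<Prod>j\<in>{1..k}. ?u j (i j))"
      unfolding pair_sum_def cinner_sum_right by (intro sum.cong refl summand)
    then show ?thesis
      by (simp add: scaleR_scaleC cinner_scaleC_right)
  qed
  \<comment> \<open>Distributivity turns the sum over all index functions into a product over pairs,
    each of which receives one of the \<open>k\<close> factors \<open>c\<close>.\<close>
  also have "\<dots> = (\<Prod>j\<in>{1..k}. of_real c * (\<Sum>t\<in>I. ?u j t))"
    using I(1) by (simp add: prod_sum_PiE prod.distrib)
  also have "\<dots> = (\<Prod>j\<in>{1..k}. h (pair_fst k \<alpha> j) (W j))"
  proof (rule prod.cong[OF refl])
    fix j assume j: "j \<in> {1..k}"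
    show "of_real c * (\<Sum>t\<in>I. ?u j t) = h (pair_fst k \<alpha> j) (W j)"
      unfolding factor[OF j] W_def bounded_functional_scaleR[OF h[OF pair_positions(1)[OF j]]]
      by (simp add: scaleR_conv_of_real)
  qed
  also have "\<dots> = h 1 (W (\<alpha> 1)) * (\<Prod>j\<in>{1..k} - {\<alpha> 1}. h (pair_fst k \<alpha> j) (W j))"
    using j0 by (subst prod.remove[of _ "\<alpha> 1"]) (simp_all only: pair_fst_first finite_atLeastAtMost)
  also have "\<dots> = cinner y ((\<Prod>j\<in>{1..k} - {\<alpha> 1}. f (pair_fst k \<alpha> j - 1) (W j)) *\<^sub>C W (\<alpha> 1))"
    unfolding h1 cinner_scaleC_right using other by (simp add: hf mult.commute)
  finally show "cinner y (c ^ k *\<^sub>R pair_sum k \<alpha> I Y Z A (e (2*k))) =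
      cinner y ((\<Prod>j\<in>{1..k} - {\<alpha> 1}. f (pair_fst k \<alpha> j - 1) (W j)) *\<^sub>C W (\<alpha> 1))" .
qed

end

section \<open>The spectral sums\<close>

context
  fixes U :: "'a::chilbert_space \<Rightarrow> 'a" and k :: nat and \<alpha> :: "nat \<Rightarrow> nat"
  assumes U: "isometry_operator U" and k: "k \<ge> 1" and \<alpha>: "pair_partition k \<alpha>"
begin

text \<open>On rank one operators the spectral sum over \<open>F\<close> coincides with an average over \<open>card F\<close> phases,
  where orthogonality of characters restores the constraint linking the two positions of a pair.
  The latter is an average of products of contractions.\<close>

lemma norm_spectral_sum_le:
  assumes F: "finite F" "F \<subseteq> sphere 0 1" and A: "\<forall>j\<in>{1..2*k - 1}. approximable (A j)"
    and \<beta>: "\<forall>j\<in>{1..2*k - 1}. \<beta> j \<ge> 0 \<and> (\<forall>x. norm (A j x) \<le> \<beta> j * norm x)"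
  shows "norm (S_partial U k \<alpha> A F x) \<le> (\<Prod>j\<in>{1..2*k - 1}. \<beta> j) * norm x"
proof -
  define m where "m = card F"
  obtain idx where idx: "bij_betw idx F {0..<m}"
    using ex_bij_betw_finite_nat[OF F(1)] by (auto simp: m_def)
  have idx_less: "idx z < m" if "z \<in> F" for z
    using idx that by (auto dest: bij_betwE)
  have idx_inj: "idx z = idx w \<longleftrightarrow> z = w" if "z \<in> F" "w \<in> F" for z w
    using idx that by (auto simp: bij_betw_def inj_on_eq_iff)
  define \<theta> where "\<theta> t z = unity_root m ^ (t * idx z)" for t z
  \<comment> \<open>Within \<open>Y t\<close> and \<open>Z t\<close> the values at the two positions
    of a pair range over \<open>F\<close> independently; the conjugate phases in \<open>Z\<close>
    let the average over \<open>t < m\<close> keep only equal values.\<close>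
  define Y where "Y t x = (\<Sum>z\<in>F. \<theta> t z *\<^sub>C eigenproj U z x)" for t x
  define Z where "Z t x = (\<Sum>z\<in>F. cnj (\<theta> t z) *\<^sub>C eigenproj U (cnj z) x)" for t x
  have \<theta>: "cmod (\<theta> t z) = 1" for t z
    by (simp add: \<theta>_def)
  have unit: "cmod z = 1" "cmod (cnj z) = 1" if "z \<in> F" for z
    using F that by auto
  have Y: "bounded_operator (Y t)" "norm (Y t x) \<le> norm x" for t x
  proof -
    show "bounded_operator (Y t)"
      unfolding Y_def
      by (intro bounded_operator_sum bounded_operator_scaled bounded_operator_eigenproj[OF U] unit)
    show "norm (Y t x) \<le> norm x"
      unfolding Y_def by (intro norm_eigenproj_combination_le[OF U] F \<theta>)
  qed
  have Z: "bounded_operator (Z t)" "norm (Z t x) \<le> norm x" for t x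
  proof -
    show "bounded_operator (Z t)"
      unfolding Z_def
      by (intro bounded_operator_sum bounded_operator_scaled bounded_operator_eigenproj[OF U] unit)
    \<comment> \<open>Reindexing by conjugation gives a combination over the conjugates of
      \<open>F\<close>, again a finite subset of the circle.\<close>
    have "Z t x = (\<Sum>z\<in>cnj ` F. cnj (\<theta> t (cnj z)) *\<^sub>C eigenproj U z x)"
      by (simp add: Z_def sum.reindex inj_on_def)
    also have "norm \<dots> \<le> norm x"
      using F by (intro norm_eigenproj_combination_le[OF U]) (auto simp: \<theta>)
    finally show "norm (Z t x) \<le> norm x" .
  qed
  have E: "bounded_operator (eigenproj U z) \<and> bounded_operator (eigenproj U (cnj z))"
    "norm (eigenproj U z x) \<le> norm x \<and> norm (eigenproj U (cnj z) x) \<le> norm x" if "z \<in> F" for z x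
    using unit[OF that] bounded_operator_eigenproj[OF U] norm_eigenproj_le[OF U] by blast+
  have corr: "(1 / real m) *\<^sub>R pair_correlation {..<m} Y Z g a b =
      1 *\<^sub>R pair_correlation F (\<lambda>z. eigenproj U z) (\<lambda>z. eigenproj U (cnj z)) g a b"
    if g: "bounded_functional g" for g a b
  proof -
    have "pair_correlation {..<m} Y Z g a b =
        (\<Sum>t<m. \<Sum>z\<in>F. \<Sum>w\<in>F. (\<theta> t w * cnj (\<theta> t z)) *\<^sub>C (g (eigenproj U (cnj z) b) *\<^sub>C eigenproj U w a))"
      unfolding pair_correlation_def Y_def Z_def bounded_functional_sum[OF g] scaleC_sum_left
      unfolding scaleC_sum_right
      by (simp add: bounded_functional_scaleC[OF g] scaleC_scaleC mult_ac)
    also have "\<dots> = (\<Sum>z\<in>F. \<Sum>w\<in>F. (\<Sum>t<m. \<theta> t w * cnj (\<theta> t z)) *\<^sub>C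
        (g (eigenproj U (cnj z) b) *\<^sub>C eigenproj U w a))"
      unfolding scaleC_sum_left by (subst sum.swap, rule sum.cong[OF refl], rule sum.swap)
    also have "\<dots> = (\<Sum>z\<in>F. \<Sum>w\<in>F. if w = z then of_nat m *\<^sub>C (g (eigenproj U (cnj z) b) *\<^sub>C eigenproj U z a) else 0)"
    proof (intro sum.cong refl)
      fix z w assume zw: "z \<in> F" "w \<in> F"
      show "(\<Sum>t<m. \<theta> t w * cnj (\<theta> t z)) *\<^sub>C (g (eigenproj U (cnj z) b) *\<^sub>C eigenproj U w a) =
          (if w = z then of_nat m *\<^sub>C (g (eigenproj U (cnj z) b) *\<^sub>C eigenproj U z a) else 0)"
        unfolding \<theta>_def using zw idx_less idx_inj by (subst unity_root_orthogonality) auto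
    qed
    also have "\<dots> = of_nat m *\<^sub>C pair_correlation F (\<lambda>z. eigenproj U z) (\<lambda>z. eigenproj U (cnj z)) g a b"
      using F(1) by (simp add: pair_correlation_def scaleC_sum_right)
    finally show ?thesis
      using F(1) by (cases "m = 0") (auto simp: scaleR_scaleC scaleC_scaleC scaleC_one m_def
          pair_correlation_def)
  qed
  \<comment> \<open>Once \<open>\<phi>\<close> vanishes on rank one operators, the reduction to that
    case is applied to a constant sequence, whose limit \<open>0\<close> forces
    \<open>\<phi> A = 0\<close>. The constant \<open>K\<close> may depend on \<open>F\<close> here,
    since it only serves to prove an identity.\<close>
  define \<phi> where "\<phi> A = S_partial U k \<alpha> A F x - (1 / real m) ^ k *\<^sub>R pair_sum k \<alpha> {..<m} Y Z A x" for A
  have "(\<lambda>\<iota>. \<phi> A) \<longlonglongrightarrow> 0"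
  proof (rule multilinear_tendsto_zero[where \<phi> = "\<lambda>_. \<phi>" and A = A
        and P = "\<lambda>_. True" and M = "2*k - 1"
        and K = "(real m ^ k + 1) * norm x"])
    fix A :: "nat \<Rightarrow> 'a \<Rightarrow> 'a" and i S T
    assume i: "i \<in> {1..2*k - 1}" and A: "\<forall>j\<in>{1..2*k - 1}. approximable (A j)"
    have A': "bounded_operator (A j)" if "j \<in> {1..2*k - 1}" for j
      using A that by (simp add: approximable_def)
    have "S_partial U k \<alpha> (A(i := \<lambda>x. S x + T x)) F x =
        S_partial U k \<alpha> (A(i := S)) F x + S_partial U k \<alpha> (A(i := T)) F x"
      unfolding S_partial_eq_pair_sum by (rule pair_sum_add[OF k \<alpha> E(1) A' i])
    moreover have "pair_sum k \<alpha> {..<m} Y Z (A(i := \<lambda>x. S x + T x)) x =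
        pair_sum k \<alpha> {..<m} Y Z (A(i := S)) x + pair_sum k \<alpha> {..<m} Y Z (A(i := T)) x"
      by (rule pair_sum_add[OF k \<alpha> conjI[OF Y(1) Z(1)] A' i])
    ultimately show "\<phi> (A(i := \<lambda>x. S x + T x)) = \<phi> (A(i := S)) + \<phi> (A(i := T))"
      by (simp add: \<phi>_def scaleR_add_right del: fun_upd_apply)
  next
    fix A :: "nat \<Rightarrow> 'a \<Rightarrow> 'a" and \<beta>
    assume \<beta>: "\<forall>j\<in>{1..2*k - 1}. \<beta> j \<ge> 0 \<and> (\<forall>x. norm (A j x) \<le> \<beta> j * norm x)"
    have "norm (S_partial U k \<alpha> A F x) \<le> real m ^ k * ((\<Prod>j\<in>{1..2*k - 1}. \<beta> j) * norm x)"
      unfolding S_partial_eq_pair_sum m_def by (intro norm_pair_sum_le[OF k \<alpha>] F E \<beta>)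
    moreover have "norm ((1 / real (card {..<m})) ^ k *\<^sub>R pair_sum k \<alpha> {..<m} Y Z A x) \<le>
        (\<Prod>j\<in>{1..2*k - 1}. \<beta> j) * norm x"
      using Y(2) Z(2) by (intro norm_pair_average_le[OF k \<alpha>] \<beta>) auto
    ultimately show "norm (\<phi> A) \<le> (real m ^ k + 1) * norm x * (\<Prod>j\<in>{1..2*k - 1}. \<beta> j)"
      unfolding \<phi>_def
      using norm_triangle_ineq4[of "S_partial U k \<alpha> A F x" "(1 / real m) ^ k *\<^sub>R pair_sum k \<alpha> {..<m} Y Z A x"]
      by (simp add: algebra_simps)
  next
    fix A :: "nat \<Rightarrow> 'a \<Rightarrow> 'a" assume "\<forall>j\<in>{1..2*k - 1}. rank_one (A j)"
    then obtain f e where fe: "\<And>j. j \<in> {1..2*k - 1} \<Longrightarrow>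
        bounded_functional (f j) \<and> A j = (\<lambda>x. f j x *\<^sub>C e j)"
      unfolding rank_one_def by metis
    \<comment> \<open>The argument \<open>x\<close> takes the place of the vector at position
      \<open>2*k\<close>, an index beyond those of the operators \<open>A j\<close>.\<close>
    define e' where "e' = e(2*k := x)"
    have e': "bounded_functional (f j) \<and> A j = (\<lambda>x. f j x *\<^sub>C e' j)" if "j \<in> {1..2*k - 1}" for j
      using fe[OF that] that k by (auto simp: e'_def)
    have snd: "bounded_functional (f (pair_snd k \<alpha> j - 1))" if "j \<in> {1..k}" for j
      using fe[OF pair_snd_pred_in[OF k \<alpha> that]] by blast
    define W where "W j = pair_correlation F (\<lambda>z. eigenproj U z) (\<lambda>z. eigenproj U (cnj z))
        (f (pair_snd k \<alpha> j - 1)) (e' (pair_fst k \<alpha> j)) (e' (pair_snd k \<alpha> j))" for j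
    define W' where "W' j = (1 / real m) *\<^sub>R pair_correlation {..<m} Y Z
        (f (pair_snd k \<alpha> j - 1)) (e' (pair_fst k \<alpha> j)) (e' (pair_snd k \<alpha> j))" for j
    have WW': "W' j = 1 *\<^sub>R W j" if "j \<in> {1..k}" for j
      unfolding W_def W'_def by (rule corr[OF snd[OF that]])
    have j0: "\<alpha> 1 \<in> {1..k}"
      using pair_partition_in[OF k \<alpha>, of 1] k by simp
    have "S_partial U k \<alpha> A F (e' (2*k)) = 1 ^ k *\<^sub>R S_partial U k \<alpha> A F (e' (2*k))"
      by simp
    also have "\<dots> = (\<Prod>j\<in>{1..k} - {\<alpha> 1}. f (pair_fst k \<alpha> j - 1) (1 *\<^sub>R W j)) *\<^sub>C (1 *\<^sub>R W (\<alpha> 1))"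
      unfolding S_partial_eq_pair_sum W_def by (rule pair_sum_rank_one[OF k \<alpha> e' F(1) E(1)])
    also have "\<dots> = (\<Prod>j\<in>{1..k} - {\<alpha> 1}. f (pair_fst k \<alpha> j - 1) (W' j)) *\<^sub>C W' (\<alpha> 1)"
      using WW' j0 by (intro arg_cong2[where f = scaleC] prod.cong) auto
    also have "\<dots> = (1 / real m) ^ k *\<^sub>R pair_sum k \<alpha> {..<m} Y Z A (e' (2*k))"
      unfolding W'_def using Y(1) Z(1)
      by (intro pair_sum_rank_one[OF k \<alpha> e', symmetric]) auto
    finally show "(\<lambda>\<iota>. \<phi> A) \<longlonglongrightarrow> 0"
      by (simp add: \<phi>_def e'_def)
  qed (use A in auto)
  then have "\<phi> A = 0"
    by (simp add: LIMSEQ_const_iff)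
  moreover have "norm ((1 / real (card {..<m})) ^ k *\<^sub>R pair_sum k \<alpha> {..<m} Y Z A x) \<le>
      (\<Prod>j\<in>{1..2*k - 1}. \<beta> j) * norm x"
    using Y(2) Z(2) by (intro norm_pair_average_le[OF k \<alpha>] \<beta>) auto
  ultimately show ?thesis
    by (simp add: \<phi>_def)
qed

text \<open>Average and spectral sum are the same continuous expression in the correlations of the
  pairs, a finite product of functionals times one vector; for each pair the orbit and the spectral
  correlation share a limit.\<close>

lemma average_and_spectral_sum_rank_one:
  assumes "\<forall>j\<in>{1..2*k - 1}. rank_one (A j)"
  obtains l where "(\<lambda>N. ergodic_average U k \<alpha> A N x) \<longlonglongrightarrow> l"
    "((\<lambda>F. S_partial U k \<alpha> A F x) \<longlongrightarrow> l) (finite_subsets_at_top (sigma_pp_a U))"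
proof -
  obtain f e where fe: "\<And>j. j \<in> {1..2*k - 1} \<Longrightarrow>
      bounded_functional (f j) \<and> A j = (\<lambda>x. f j x *\<^sub>C e j)"
    using assms unfolding rank_one_def by metis
  define e' where "e' = e(2*k := x)"
  have e': "bounded_functional (f j) \<and> A j = (\<lambda>x. f j x *\<^sub>C e' j)" if "j \<in> {1..2*k - 1}" for j
    using fe[OF that] that k by (auto simp: e'_def)
  have x: "e' (2*k) = x"
    by (simp add: e'_def)
  let ?g = "\<lambda>j. f (pair_snd k \<alpha> j - 1)" and ?a = "\<lambda>j. e' (pair_fst k \<alpha> j)"
    and ?b = "\<lambda>j. e' (pair_snd k \<alpha> j)"
  have "\<forall>j\<in>{1..k}. \<exists>l. orbit_correlation U (?g j) (?a j) (?b j) \<longlonglongrightarrow> l \<and>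
      (spectral_correlation U (?g j) (?a j) (?b j) \<longlongrightarrow> l) (finite_subsets_at_top (sigma_pp_a U))"
  proof
    fix j assume "j \<in> {1..k}"
    then have "bounded_functional (?g j)"
      using fe[OF pair_snd_pred_in[OF k \<alpha>]] by blast
    from correlation_limit[OF U this, of "?a j" "?b j"]
    show "\<exists>l. orbit_correlation U (?g j) (?a j) (?b j) \<longlonglongrightarrow> l \<and>
        (spectral_correlation U (?g j) (?a j) (?b j) \<longlongrightarrow> l) (finite_subsets_at_top (sigma_pp_a U))"
      by blast
  qed
  then obtain l where l: "\<And>j. j \<in> {1..k} \<Longrightarrow> orbit_correlation U (?g j) (?a j) (?b j) \<longlonglongrightarrow> l j"
    "\<And>j. j \<in> {1..k} \<Longrightarrow>
      (spectral_correlation U (?g j) (?a j) (?b j) \<longlongrightarrow> l j) (finite_subsets_at_top (sigma_pp_a U))"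
    by metis
  define L where "L = (\<Prod>j\<in>{1..k} - {\<alpha> 1}. f (pair_fst k \<alpha> j - 1) (l j)) *\<^sub>C l (\<alpha> 1)"
  have j0: "\<alpha> 1 \<in> {1..k}"
    using pair_partition_in[OF k \<alpha>, of 1] k by simp
  have f: "bounded_functional (f (pair_fst k \<alpha> j - 1))" if "j \<in> {1..k} - {\<alpha> 1}" for j
    using fe[OF pair_fst_pred_in[OF k \<alpha> that]] by blast
  have orbit: "orbit_correlation U g a b N =
      (1 / real N) *\<^sub>R pair_correlation {..<N} (\<lambda>n. U ^^ n) (\<lambda>n. U ^^ n) g a b" for g a b N
    by (simp add: orbit_correlation_def pair_correlation_def)
  have "ergodic_average U k \<alpha> A N x =
      (\<Prod>j\<in>{1..k} - {\<alpha> 1}. f (pair_fst k \<alpha> j - 1) (orbit_correlation U (?g j) (?a j) (?b j) N)) *\<^sub>C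
        orbit_correlation U (?g (\<alpha> 1)) (?a (\<alpha> 1)) (?b (\<alpha> 1)) N" for N
    unfolding ergodic_average_eq_pair_sum orbit
    unfolding x[symmetric] using isometry_bounded[OF isometry_funpow[OF U]]
    by (intro pair_sum_rank_one[OF k \<alpha> e']) auto
  moreover have "(\<lambda>N. (\<Prod>j\<in>{1..k} - {\<alpha> 1}. f (pair_fst k \<alpha> j - 1) (orbit_correlation U (?g j) (?a j) (?b j) N)) *\<^sub>C
        orbit_correlation U (?g (\<alpha> 1)) (?a (\<alpha> 1)) (?b (\<alpha> 1)) N) \<longlonglongrightarrow> L"
    unfolding L_def
    by (intro tendsto_scaleC tendsto_prod bounded_functional_tendsto[OF f] l j0) auto
  ultimately have avg: "(\<lambda>N. ergodic_average U k \<alpha> A N x) \<longlonglongrightarrow> L"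
    by presburger
  have spec: "S_partial U k \<alpha> A F x =
      (\<Prod>j\<in>{1..k} - {\<alpha> 1}. f (pair_fst k \<alpha> j - 1) (spectral_correlation U (?g j) (?a j) (?b j) F)) *\<^sub>C
        spectral_correlation U (?g (\<alpha> 1)) (?a (\<alpha> 1)) (?b (\<alpha> 1)) F"
    if F: "finite F" "F \<subseteq> sigma_pp_a U" for F
  proof -
    have spectral: "spectral_correlation U g a b F =
        pair_correlation F (\<lambda>z. eigenproj U z) (\<lambda>z. eigenproj U (cnj z)) g a b" for g a b
      by (simp add: spectral_correlation_def pair_correlation_def)
    have unit: "cmod z = 1" "cmod (cnj z) = 1" if "z \<in> F" for z
      using F that by (auto simp: sigma_pp_a_def sigma_pp_def)
    have "1 ^ k *\<^sub>R pair_sum k \<alpha> F (\<lambda>z. eigenproj U z) (\<lambda>z. eigenproj U (cnj z)) A (e' (2*k)) =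
      (\<Prod>j\<in>{1..k} - {\<alpha> 1}. f (pair_fst k \<alpha> j - 1) (1 *\<^sub>R spectral_correlation U (?g j) (?a j) (?b j) F)) *\<^sub>C
        (1 *\<^sub>R spectral_correlation U (?g (\<alpha> 1)) (?a (\<alpha> 1)) (?b (\<alpha> 1)) F)"
      unfolding spectral
      using F(1) unit bounded_operator_eigenproj[OF U]
      by (intro pair_sum_rank_one[OF k \<alpha> e']) blast+
    then show ?thesis
      by (simp add: S_partial_eq_pair_sum x)
  qed
  have "((\<lambda>F. (\<Prod>j\<in>{1..k} - {\<alpha> 1}. f (pair_fst k \<alpha> j - 1) (spectral_correlation U (?g j) (?a j) (?b j) F)) *\<^sub>C
        spectral_correlation U (?g (\<alpha> 1)) (?a (\<alpha> 1)) (?b (\<alpha> 1)) F) \<longlongrightarrow> L) (finite_subsets_at_top (sigma_pp_a U))"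
    unfolding L_def
    by (intro tendsto_scaleC tendsto_prod bounded_functional_tendsto[OF f] l j0) auto
  then have "((\<lambda>F. S_partial U k \<alpha> A F x) \<longlongrightarrow> L) (finite_subsets_at_top (sigma_pp_a U))"
    by (rule Lim_transform_eventually)
      (rule eventually_finite_subsets_at_top_weakI, simp only: spec)
  with avg that show thesis
    by blast
qed

lemma norm_ergodic_average_le:
  assumes "\<forall>j\<in>{1..2*k - 1}. \<beta> j \<ge> 0 \<and> (\<forall>x. norm (A j x) \<le> \<beta> j * norm x)"
  shows "norm (ergodic_average U k \<alpha> A N x) \<le> (\<Prod>j\<in>{1..2*k - 1}. \<beta> j) * norm x"
  using norm_pair_average_le[OF k \<alpha> finite_lessThan _ assms, of N "\<lambda>n. U ^^ n" "\<lambda>n. U ^^ n" x]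
  by (simp add: ergodic_average_eq_pair_sum isometry_pow_norm[OF U])

lemma bounded_operator_ergodic_average:
  assumes "\<forall>j\<in>{1..2*k - 1}. bounded_operator (A j)"
  shows "bounded_operator (ergodic_average U k \<alpha> A N)"
  unfolding ergodic_average_def scaleR_scaleC
  using assms
  by (intro bounded_operator_scaled bounded_operator_sum bounded_operator_alt_prod
      isometry_bounded[OF isometry_funpow[OF U]]) auto

text \<open>The difference tends to \<open>0\<close> along the product filter. Comparing two
  averages through one spectral sum makes the averages Cauchy, and comparing spectral sums with one
  late average then gives them the same limit.\<close>

lemma average_and_spectral_sum_limit:
  assumes A: "\<forall>j\<in>{1..2*k - 1}. approximable (A j)"
  obtains l where "(\<lambda>N. ergodic_average U k \<alpha> A N x) \<longlonglongrightarrow> l"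
    "((\<lambda>F. S_partial U k \<alpha> A F x) \<longlongrightarrow> l) (finite_subsets_at_top (sigma_pp_a U))"
proof -
  let ?G = "finite_subsets_at_top (sigma_pp_a U)"
  define \<phi> where "\<phi> = (\<lambda>(N, F) A. ergodic_average U k \<alpha> A N x - S_partial U k \<alpha> A F x)"
  define P where "P = (\<lambda>(N::nat, F). finite F \<and> F \<subseteq> (sphere 0 1 :: complex set))"
  have "((\<lambda>\<iota>. \<phi> \<iota> A) \<longlongrightarrow> 0) (sequentially \<times>\<^sub>F ?G)"
  proof (rule multilinear_tendsto_zero[where P = P and M = "2*k - 1" and K = "2 * norm x" and A = A])
    have "eventually (\<lambda>F. finite F \<and> F \<subseteq> sphere 0 1) ?G"
      by (rule eventually_finite_subsets_at_top_weakI) (auto simp: sigma_pp_a_def sigma_pp_def)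
    then show "eventually P (sequentially \<times>\<^sub>F ?G)"
      unfolding eventually_prod_filter P_def by (auto intro: exI[of _ "\<lambda>_. True"])
  next
    fix \<iota> and A :: "nat \<Rightarrow> 'a \<Rightarrow> 'a" and i S T
    assume P: "P \<iota>" and i: "i \<in> {1..2*k - 1}" and A: "\<forall>j\<in>{1..2*k - 1}. approximable (A j)"
    obtain N F where \<iota>: "\<iota> = (N, F)" "F \<subseteq> sphere 0 1"
      using P by (cases \<iota>) (auto simp: P_def)
    have A': "bounded_operator (A j)" if "j \<in> {1..2*k - 1}" for j
      using A that by (simp add: approximable_def)
    have pow: "bounded_operator (U ^^ n) \<and> bounded_operator (U ^^ n)" for n
      by (simp add: isometry_bounded[OF isometry_funpow[OF U]])
    have E: "bounded_operator (eigenproj U z) \<and> bounded_operator (eigenproj U (cnj z))" if "z \<in> F" for z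
      using \<iota>(2) that by (auto intro!: bounded_operator_eigenproj[OF U])
    have "ergodic_average U k \<alpha> (A(i := \<lambda>x. S x + T x)) N x =
        ergodic_average U k \<alpha> (A(i := S)) N x + ergodic_average U k \<alpha> (A(i := T)) N x"
      unfolding ergodic_average_eq_pair_sum scaleR_add_right[symmetric]
      by (rule arg_cong[where f = "scaleR _"], rule pair_sum_add[OF k \<alpha> pow A' i])
    moreover have "S_partial U k \<alpha> (A(i := \<lambda>x. S x + T x)) F x =
        S_partial U k \<alpha> (A(i := S)) F x + S_partial U k \<alpha> (A(i := T)) F x"
      unfolding S_partial_eq_pair_sum by (rule pair_sum_add[OF k \<alpha> E A' i])
    ultimately show "\<phi> \<iota> (A(i := \<lambda>x. S x + T x)) = \<phi> \<iota> (A(i := S)) + \<phi> \<iota> (A(i := T))"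
      by (simp add: \<phi>_def \<iota>(1) del: fun_upd_apply)
  next
    fix \<iota> and A :: "nat \<Rightarrow> 'a \<Rightarrow> 'a" and \<beta>
    assume P: "P \<iota>" and A: "\<forall>j\<in>{1..2*k - 1}. approximable (A j)"
      and \<beta>: "\<forall>j\<in>{1..2*k - 1}. \<beta> j \<ge> 0 \<and> (\<forall>x. norm (A j x) \<le> \<beta> j * norm x)"
    obtain N F where \<iota>: "\<iota> = (N, F)" "finite F" "F \<subseteq> sphere 0 1"
      using P by (cases \<iota>) (auto simp: P_def)
    show "norm (\<phi> \<iota> A) \<le> 2 * norm x * (\<Prod>j\<in>{1..2*k - 1}. \<beta> j)"
      using norm_ergodic_average_le[OF \<beta>, of N x] norm_spectral_sum_le[OF \<iota>(2,3) A \<beta>, of x]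
        norm_triangle_ineq4[of "ergodic_average U k \<alpha> A N x" "S_partial U k \<alpha> A F x"]
      by (simp add: \<phi>_def \<iota>(1) algebra_simps)
  next
    fix A :: "nat \<Rightarrow> 'a \<Rightarrow> 'a" assume "\<forall>j\<in>{1..2*k - 1}. rank_one (A j)"
    then obtain l where l: "(\<lambda>N. ergodic_average U k \<alpha> A N x) \<longlonglongrightarrow> l"
      "((\<lambda>F. S_partial U k \<alpha> A F x) \<longlongrightarrow> l) ?G"
      by (rule average_and_spectral_sum_rank_one)
    have "((\<lambda>\<iota>. ergodic_average U k \<alpha> A (fst \<iota>) x - S_partial U k \<alpha> A (snd \<iota>) x) \<longlongrightarrow> l - l)
        (sequentially \<times>\<^sub>F ?G)"
      by (intro tendsto_diff filterlim_compose[OF l(1) filterlim_fst] filterlim_compose[OF l(2) filterlim_snd])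
    then show "((\<lambda>\<iota>. \<phi> \<iota> A) \<longlongrightarrow> 0) (sequentially \<times>\<^sub>F ?G)"
      by (simp add: \<phi>_def case_prod_beta)
  qed (use A in auto)
  note lim = this
  have near: "\<exists>Q R. eventually Q sequentially \<and> eventually R ?G \<and>
      (\<forall>N F. Q N \<longrightarrow> R F \<longrightarrow> dist (ergodic_average U k \<alpha> A N x) (S_partial U k \<alpha> A F x) < e)" if "e > 0" for e
    using tendstoD[OF lim that] unfolding eventually_prod_filter \<phi>_def by (simp add: dist_norm)
  have "Cauchy (\<lambda>N. ergodic_average U k \<alpha> A N x)"
  proof (rule metric_CauchyI)
    fix e :: real assume "e > 0"
    then have "e / 2 > 0"
      by simp
    from near[OF this] obtain Q R where QR: "eventually Q sequentially" "eventually R ?G"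
      "\<And>N F. Q N \<Longrightarrow> R F \<Longrightarrow> dist (ergodic_average U k \<alpha> A N x) (S_partial U k \<alpha> A F x) < e / 2"
      by blast
    \<comment> \<open>One admissible \<open>F\<close> serves as a common reference for all large
      \<open>N\<close>; it exists because the filter is proper.\<close>
    obtain F where "R F"
      using eventually_happens'[OF finite_subsets_at_top_neq_bot QR(2)] by blast
    moreover obtain M where "\<And>N. N \<ge> M \<Longrightarrow> Q N"
      using QR(1) unfolding eventually_sequentially by blast
    ultimately show "\<exists>M. \<forall>m\<ge>M. \<forall>n\<ge>M.
        dist (ergodic_average U k \<alpha> A m x) (ergodic_average U k \<alpha> A n x) < e"
      using QR(3) by (meson dist_triangle_half_l)
  qed
  then obtain l where l: "(\<lambda>N. ergodic_average U k \<alpha> A N x) \<longlonglongrightarrow> l"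
    using Cauchy_convergent convergent_def by blast
  have "((\<lambda>F. S_partial U k \<alpha> A F x) \<longlongrightarrow> l) ?G"
  proof (rule tendstoI)
    fix e :: real assume "e > 0"
    then have e: "e / 2 > 0"
      by simp
    from near[OF this] obtain Q R where QR: "eventually Q sequentially" "eventually R ?G"
      "\<And>N F. Q N \<Longrightarrow> R F \<Longrightarrow> dist (ergodic_average U k \<alpha> A N x) (S_partial U k \<alpha> A F x) < e / 2"
      by blast
    obtain N where N: "Q N" "dist (ergodic_average U k \<alpha> A N x) l < e / 2"
      using eventually_happens'[OF sequentially_bot eventually_conj[OF QR(1) tendstoD[OF l e]]] by blast
    show "\<forall>\<^sub>F F in ?G. dist (S_partial U k \<alpha> A F x) l < e"
      using QR(2)
    proof eventually_elim
      case (elim F)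
      show ?case
        using QR(3)[OF N(1) elim] N(2) dist_triangle_half_r by blast
    qed
  qed
  with l that show thesis
    by blast
qed

end

section \<open>The ergodic theorem\<close>

text \<open>Both families converge in norm at every vector, so weak convergence follows by
  continuity of the inner product. \<open>S_op\<close> is a definite description, and uniqueness of
  weak limits identifies it with the pointwise limit \<open>L\<close>.\<close>

theorem theorem2p5:
  fixes U :: "'a::chilbert_space \<Rightarrow> 'a"
    and A :: "nat \<Rightarrow> 'a \<Rightarrow> 'a"
    and \<alpha> :: "nat \<Rightarrow> nat"
    and k :: nat
  assumes "unitary_operator U"
    and "k \<ge> 1"
    and "\<And>i. i \<in> {1..2*k - 1} \<Longrightarrow> compact_operator (A i)"
    and "pair_partition k \<alpha>"
  shows "wot_tendsto (ergodic_average U k \<alpha> A) (S_op U k \<alpha> A) sequentially"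
proof -
  have U: "isometry_operator U"
    by (rule unitary_isometry[OF assms(1)])
  note k = assms(2) and \<alpha> = assms(4)
  have A: "\<forall>j\<in>{1..2*k - 1}. approximable (A j)"
    using assms(3) compact_operator_approximable by blast
  have "\<forall>x. \<exists>l. (\<lambda>N. ergodic_average U k \<alpha> A N x) \<longlonglongrightarrow> l \<and>
      ((\<lambda>F. S_partial U k \<alpha> A F x) \<longlongrightarrow> l) (finite_subsets_at_top (sigma_pp_a U))"
    using average_and_spectral_sum_limit[OF U k \<alpha> A] by metis
  then obtain L where L: "\<And>x. (\<lambda>N. ergodic_average U k \<alpha> A N x) \<longlonglongrightarrow> L x"
    "\<And>x. ((\<lambda>F. S_partial U k \<alpha> A F x) \<longlongrightarrow> L x) (finite_subsets_at_top (sigma_pp_a U))"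
    by metis
  have A': "\<forall>j\<in>{1..2*k - 1}. bounded_operator (A j)"
    using A by (simp add: approximable_def)
  then have "\<forall>j\<in>{1..2*k - 1}. \<exists>B. B \<ge> 0 \<and> (\<forall>x. norm (A j x) \<le> B * norm x)"
    using bounded_operator_bound by metis
  then obtain \<beta> where \<beta>: "\<forall>j\<in>{1..2*k - 1}. \<beta> j \<ge> 0 \<and> (\<forall>x. norm (A j x) \<le> \<beta> j * norm x)"
    by metis
  note avg = bounded_operator_ergodic_average[OF U k \<alpha> A']
  \<comment> \<open>Boundedness of the limit is part of \<open>wot_tendsto\<close>; it is inherited
    from the averages, whose bound is uniform in \<open>N\<close>.\<close>
  have "bounded_operator L"
  proof (rule bounded_operatorI)
    show "L (x + y) = L x + L y" for x y
      using L(1)[of "x + y"] tendsto_add[OF L(1)[of x] L(1)[of y]]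
      by (simp add: linear_add[OF bounded_operator_linear[OF avg]] LIMSEQ_unique)
    show "L (c *\<^sub>C x) = c *\<^sub>C L x" for c x
      using L(1)[of "c *\<^sub>C x"] tendsto_scaleC[OF tendsto_const L(1)[of x], of c]
      by (simp add: bounded_operator_scaleC[OF avg] LIMSEQ_unique)
    show "norm (L x) \<le> (\<Prod>j\<in>{1..2*k - 1}. \<beta> j) * norm x" for x
      by (rule LIMSEQ_le_const2[OF tendsto_norm[OF L(1)]])
        (use norm_ergodic_average_le[OF U k \<alpha> \<beta>] in blast)
  qed
  then have "wot_tendsto (ergodic_average U k \<alpha> A) L sequentially"
    "wot_tendsto (S_partial U k \<alpha> A) L (finite_subsets_at_top (sigma_pp_a U))"
    unfolding wot_tendsto_def by (auto intro!: tendsto_cinner tendsto_const L)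
  then show ?thesis
    unfolding S_op_def by (simp add: wot_Lim_eq finite_subsets_at_top_neq_bot)
qed

end
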